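(* Let $b(\lambda)$ and $k(\lambda)$ be invertible scalar one-space dynamical matrices and $R_{12}$ a non-dynamical solution of the Yang–Baxter equation. Let $$A_{12}=b_1^{-1}b_2^{-1}R_{12}b_1b_2,\quad B_{12}=b_2^{-1}b_2(h_1),\quad C_{12}=b_1^{-1}b_1(h_2),\quad D_{12}=\big((bk)_1(h_2)\big)^{-1}(bk)_2^{-1}\,R_{12}\,(bk)_1\,(bk)_2(h_1),$$ and assume $D$ has zero weight: $[h_i\otimes1+1\otimes h_i,D_{12}]=0$ for all $i$. Let $\mathcal Q$ be a scalar non-dynamical matrix with $R_{12}\mathcal Q_1\mathcal Q_2=\mathcal Q_2\mathcal Q_1R_{12}$, put $\tilde k=b^{-1}\mathcal Q\,b\,k$, and let $\chi(\lambda)$ be a scalar solution of the dual reflection equation (only the fact that $\chi_0^t(\lambda)$ acts in space $0$ alone matters). For $N\ge1$ put $s_m=h_{2m+1}+h_{2m+3}+\dots+h_{2N-1}$ for $0\le m\le N-1$, $s_N=0$, and consider the $N$-site monodromy operator on the auxiliary space $0$ and the quantum spaces $1,\dots,2N$: $$\mathcal T=\chi_0^t\;\Big[\prod_{m=N,N-1,\dots,1}A_{0\,2m}(s_m)\,C_{0\,2m-1}(s_m)\Big]\;\tilde k_0(s_0)\;\Big[\prod_{m=1,2,\dots,N}D_{0\,2m-1}(s_m)\,B_{0\,2m}(s_m)\Big]\;e^{\gamma\mathcal D_0}$$ (products written from left to right in the indicated order of $m$). Then $$\mathcal T=\mathcal O_N^{-1}\Big\{\chi_0^t\,b_0^{-1}\,R_{0\,2N}R_{0\,2N-2}\cdots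 R_{02}\;\mathcal Q_0\;R_{01}R_{03}\cdots R_{0\,2N-1}\;b_0\,k_0\,e^{\gamma\mathcal D_0}\Big\}\,\mathcal O_N,$$ where $\mathcal O_N$ acts only in the quantum spaces and is given by $$\mathcal O_N=\prod_{m=N,N-1,\dots,1}b_{2m}(s_m)\,(bk)_{2m-1}(s_m)=b_{2N}\,(bk)_{2N-1}\,b_{2N-2}(h_{2N-1})\,(bk)_{2N-3}(h_{2N-1})\cdots b_2(s_1)\,(bk)_1(s_1).$$
   Context: Setting. Fix $n\ge 1$, $V=\mathbb C^n$ with matrix units $e_{ij}$; $h_i=e_{ii}$ is the basis of the Cartan subalgebra $\mathfrak h$ of $gl(n)$; $\gamma\in\mathbb C$, $\gamma\neq0$; $\lambda\in\mathbb C^n$ are the dynamical variables; $\epsilon_i$ is the $i$-th standard basis vector. Each space is a copy of $V$, or of $V\otimes\mathbb C[[u]]$ in which case matrices have coefficients in formal power series and space $j$ carries the parameter $u_j$. A "dynamical matrix" is a function of $\lambda$ with values in $\mathrm{End}(V)$ (one-space) or $\mathrm{End}(V)\otimes\mathrm{End}(V)$ (two-space), possibly with power series coefficients; invertible means invertible for every $\lambda$. Subscripts indicate the tensor factors in which a matrix acts ($X_{0a}$ acts in spaces $0$ and $a$); the argument $\lambda$ is omitted. "Non-dynamical" means invariant under $\lambda\mapsto\lambda+\gamma\epsilon_i$ for every $i$. The Yang–Baxter equation is $R_{12}R_{13}R_{23}=R_{23}R_{13}R_{12}$. Dynamical shift. In $h_a$ attached to a shift, the index $a$ labels a space (not a basis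 element): if $f(\lambda)$ does not act in the distinct spaces $a_1,\dots,a_r$, then $f(h_{a_1}+\dots+h_{a_r})=f(\lambda+\gamma h_{a_1}+\dots+\gamma h_{a_r}):=\sum_{i_1,\dots,i_r} f(\lambda+\gamma\epsilon_{i_1}+\dots+\gamma\epsilon_{i_r})\,(e_{i_1i_1})_{a_1}\cdots(e_{i_ri_r})_{a_r}$; $f(0)$ in this shift notation is $f(\lambda)$. Shift operator. $e^{\gamma\mathcal D_0}$ acts on functions $\psi$ of $\lambda$ with values in the tensor product of all spaces by $(e^{\gamma\mathcal D_0}\psi)(\lambda)=\sum_i (e_{ii})_0\,\psi(\lambda+\gamma\epsilon_i)$; all matrices above act on such functions by pointwise multiplication, and the stated identity is an identity of operators. $\chi_0^t$ denotes the transpose of $\chi$ acting in space $0$. *)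

theory Defs
  imports "HOL-Analysis.Analysis" "HOL-Computational_Algebra.Formal_Power_Series"
    "HOL-Library.Multiset" "HOL-Library.FuncSet"
begin

section \<open>Formal power series in the spectral parameters\<close>

text \<open>
  Power series in the variables \<open>u 0, u 1, u 2, \<dots>\<close>. A monomial is the multiset of its
  variables: \<open>{#0, 0, 3#}\<close> stands for \<open>u 0 ^ 2 * u 3\<close>.
\<close>

typedef 'a mfps = "UNIV :: (nat multiset \<Rightarrow> 'a) set"
  morphisms mfps_nth Abs_mfps
  by simp

setup_lifting type_definition_mfps

lemma finite_divisors_mset: "finite {p. p \<subseteq># (m :: 'b multiset)}"
proof (induction m)
  case empty
  show ?case by simp
next
  case (add x m)
  have "{p. p \<subseteq># add_mset x m} \<subseteq> {p. p \<subseteq># m} \<union> add_mset x ` {p. p \<subseteq># m}"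
  proof
    fix p assume "p \<in> {p. p \<subseteq># add_mset x m}"
    then have p: "p \<subseteq># add_mset x m" by simp
    show "p \<in> {p. p \<subseteq># m} \<union> add_mset x ` {p. p \<subseteq># m}"
    proof (cases "x \<in># p")
      case True
      then obtain q where "p = add_mset x q" by (metis insert_DiffM)
      with p show ?thesis by auto
    next
      case False
      with p have "p \<subseteq># m"
        by (metis add_mset_remove_trivial diff_single_trivial subset_eq_diff_conv
            add_mset_add_single)
      then show ?thesis by simp
    qed
  qed
  with add show ?case by (meson finite_UnI finite_imageI finite_subset)
qed

instantiation mfps :: (comm_ring_1) comm_ring_1
begin

lift_definition zero_mfps :: "'a mfps" is "\<lambda>_. 0" .

lift_definition one_mfps :: "'a mfps" is "\<lambda>m. if m = {#} then 1 else 0" .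

lift_definition plus_mfps :: "'a mfps \<Rightarrow> 'a mfps \<Rightarrow> 'a mfps" is "\<lambda>f g m. f m + g m" .

lift_definition uminus_mfps :: "'a mfps \<Rightarrow> 'a mfps" is "\<lambda>f m. - f m" .

lift_definition minus_mfps :: "'a mfps \<Rightarrow> 'a mfps \<Rightarrow> 'a mfps" is "\<lambda>f g m. f m - g m" .

lift_definition times_mfps :: "'a mfps \<Rightarrow> 'a mfps \<Rightarrow> 'a mfps"
  is "\<lambda>f g m. \<Sum>p | p \<subseteq># m. f p * g (m - p)" .

instance
proof
  fix a b c :: "'a mfps"
  show "a + b + c = a + (b + c)" by transfer (simp add: add.assoc)
  show "a + b = b + a" by transfer (simp add: add.commute)
  show "0 + a = a" by transfer simp
  show "- a + a = 0" by transfer simp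
  show "a - b = a + - b" by transfer simp
  show "(0 :: 'a mfps) \<noteq> 1"
  proof (transfer, rule notI)
    assume "(\<lambda>_. 0) = (\<lambda>m :: nat multiset. if m = {#} then 1 else (0 :: 'a))"
    then show False by (metis zero_neq_one)
  qed
  show "(a + b) * c = a * c + b * c"
    by transfer (simp add: distrib_right sum.distrib)
  show "1 * a = a"
  proof (transfer, rule ext)
    fix a :: "nat multiset \<Rightarrow> 'a" and m
    have "(\<Sum>p | p \<subseteq># m. (if p = {#} then 1 else 0) * a (m - p)) =
      (\<Sum>p | p \<subseteq># m. if p = {#} then a m else 0)"
      by (rule sum.cong) auto
    also have "\<dots> = a m" by (simp add: sum.delta finite_divisors_mset)
    finally show "(\<Sum>p | p \<subseteq># m. (if p = {#} then 1 else 0) * a (m - p)) = a m" .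
  qed
  show "a * b = b * a"
  proof (transfer, rule ext)
    fix a b :: "nat multiset \<Rightarrow> 'a" and m
    show "(\<Sum>p | p \<subseteq># m. a p * b (m - p)) = (\<Sum>p | p \<subseteq># m. b p * a (m - p))"
      by (rule sum.reindex_bij_witness[where i = "\<lambda>p. m - p" and j = "\<lambda>p. m - p"])
        (auto simp: subset_mset.diff_diff_right mult.commute)
  qed
  show "a * b * c = a * (b * c)"
  proof (transfer, rule ext)
    fix a b c :: "nat multiset \<Rightarrow> 'a" and m
    have "(\<Sum>p | p \<subseteq># m. (\<Sum>q | q \<subseteq># p. a q * b (p - q)) * c (m - p)) =
      (\<Sum>(p, q) \<in> (SIGMA p:{p. p \<subseteq># m}. {q. q \<subseteq># p}). a q * b (p - q) * c (m - p))"
      by (subst sum.Sigma[symmetric]) (auto simp: finite_divisors_mset sum_distrib_right)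
    also have "\<dots> = (\<Sum>(q, r) \<in> (SIGMA q:{q. q \<subseteq># m}. {r. r \<subseteq># m - q}).
        a q * b r * c (m - q - r))"
    proof (rule sum.reindex_bij_witness[where i = "\<lambda>(q, r). (q + r, q)"
          and j = "\<lambda>(p, q). (q, p - q)"], goal_cases)
      case (2 x)
      then obtain p q where x: "x = (p, q)" "p \<subseteq># m" "q \<subseteq># p" by auto
      then have "q \<subseteq># m" by auto
      moreover have "p - q \<subseteq># m - q"
        using x(2) by (simp add: subseteq_mset_def diff_le_mono)
      ultimately show ?case using x by auto
    next
      case (4 x)
      then obtain q r where x: "x = (q, r)" "q \<subseteq># m" "r \<subseteq># m - q" by auto
      then have "q + r \<subseteq># m"
        by (metis subset_mset.add_diff_inverse subset_mset.add_left_mono)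
      then show ?case using x by auto
    next
      case (5 x)
      then show ?case
        by (auto simp: diff_diff_add subset_mset.add_diff_inverse)
    qed auto
    also have "\<dots> = (\<Sum>q | q \<subseteq># m. a q * (\<Sum>r | r \<subseteq># m - q. b r * c (m - q - r)))"
      by (subst sum.Sigma[symmetric])
        (auto simp: finite_divisors_mset sum_distrib_left mult.assoc)
    finally show "(\<Sum>p | p \<subseteq># m. (\<Sum>q | q \<subseteq># p. a q * b (p - q)) * c (m - p)) =
      (\<Sum>q | q \<subseteq># m. a q * (\<Sum>r | r \<subseteq># m - q. b r * c (m - q - r)))" .
  qed
qed

end

text \<open>
  \<open>in_var a f\<close> is \<open>f(u a)\<close>, and \<open>in_vars a b F\<close> is \<open>F(u a, u b)\<close> for \<open>a \<noteq> b\<close>. A series in two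
  variables is an element of \<^typ>\<open>complex fps fps\<close>, the outer index being the exponent of the
  first variable.
\<close>

definition in_var :: "nat \<Rightarrow> complex fps \<Rightarrow> complex mfps" where
  "in_var a f = Abs_mfps (\<lambda>m. if set_mset m \<subseteq> {a} then fps_nth f (count m a) else 0)"

definition in_vars :: "nat \<Rightarrow> nat \<Rightarrow> complex fps fps \<Rightarrow> complex mfps" where
  "in_vars a b F = Abs_mfps (\<lambda>m. if set_mset m \<subseteq> {a, b}
     then fps_nth (fps_nth F (count m a)) (count m b) else 0)"


section \<open>Dynamical operators on the tensor product of the spaces\<close>

text \<open>
  The copies of \<open>V\<close> are labelled by natural numbers. A vector is given by its components
  \<open>v x\<close> along the basis tensors \<open>e_(x 0) \<otimes> e_(x 1) \<otimes> \<dots>\<close>. The tensor product of the spaces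
  \<open>0, \<dots>, M\<close> consists of the \<open>v\<close> for which \<open>v x\<close> depends only on \<open>x 0, \<dots>, x M\<close> (and contains only
  the variables \<open>u 0, \<dots>, u M\<close>). Operators that act in these spaces alone leave all further labels
  untouched, so one may let them act on all \<open>v\<close> without changing the meaning of an operator
  identity.
\<close>

type_synonym 'n vect = "(nat \<Rightarrow> 'n) \<Rightarrow> complex mfps"
type_synonym 'n dynop = "complex ^ 'n \<Rightarrow> 'n vect \<Rightarrow> 'n vect"
type_synonym 'n mat1 = "(complex fps) ^ 'n ^ 'n"
type_synonym 'n mat2 = "(complex fps fps) ^ ('n \<times> 'n) ^ ('n \<times> 'n)"

definition act1 :: "nat \<Rightarrow> (complex ^ 'n \<Rightarrow> 'n mat1) \<Rightarrow> 'n::finite dynop" where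
  "act1 a X l v x = (\<Sum>j\<in>UNIV. in_var a (X l $ x a $ j) * v (x(a := j)))"

text \<open>\<open>X $ (i, i') $ (j, j')\<close> is the coefficient of \<open>e_ij \<otimes> e_i'j'\<close>.\<close>

definition act2 :: "nat \<Rightarrow> nat \<Rightarrow> (complex ^ 'n \<Rightarrow> 'n mat2) \<Rightarrow> 'n::finite dynop" where
  "act2 a b X l v x = (\<Sum>j\<in>UNIV. \<Sum>j'\<in>UNIV.
     in_vars a b (X l $ (x a, x b) $ (j, j')) * v (x(a := j, b := j')))"

definition dmult :: "'n dynop \<Rightarrow> 'n dynop \<Rightarrow> 'n dynop" (infixl "\<odot>" 70) where
  "(X \<odot> Y) l = X l \<circ> Y l"

definition dinv :: "'n dynop \<Rightarrow> 'n dynop" where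
  "dinv X l = inv (X l)"

definition oprod :: "(nat \<Rightarrow> 'n dynop) \<Rightarrow> nat list \<Rightarrow> 'n dynop" where
  "oprod X ms = foldr (\<lambda>m Y. X m \<odot> Y) ms (\<lambda>l. id)"

text \<open>\<open>basis_proj S i\<close> is the product of the \<open>(e_ii)_a\<close> with \<open>i = i a\<close>, over all spaces \<open>a\<close> in \<open>S\<close>.\<close>

definition basis_proj :: "nat set \<Rightarrow> (nat \<Rightarrow> 'n) \<Rightarrow> 'n vect \<Rightarrow> 'n vect" where
  "basis_proj S i v x = (if \<forall>a\<in>S. x a = i a then v x else 0)"

abbreviation eps :: "'n \<Rightarrow> complex ^ 'n::finite" where
  "eps i \<equiv> axis i 1"

text \<open>
  \<open>shift \<gamma> {a1, \<dots>, ar} f\<close> is \<open>f(h_a1 + \<dots> + h_ar)\<close>; it is only used when \<open>f\<close> does not act in the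
  spaces \<open>a1, \<dots>, ar\<close>.
\<close>

definition shift :: "complex \<Rightarrow> nat set \<Rightarrow> 'n dynop \<Rightarrow> 'n::finite dynop" where
  "shift \<gamma> S f l v x =
     (\<Sum>i \<in> S \<rightarrow>\<^sub>E UNIV. f (l + (\<Sum>a\<in>S. \<gamma> *s eps (i a))) (basis_proj S i v) x)"

definition non_dynamical :: "complex \<Rightarrow> (complex ^ 'n \<Rightarrow> 'm) \<Rightarrow> bool" where
  "non_dynamical \<gamma> X \<longleftrightarrow> (\<forall>l i. X (l + \<gamma> *s eps i) = X l)"

definition yang_baxter :: "(complex ^ 'n \<Rightarrow> 'n::finite mat2) \<Rightarrow> bool" where
  "yang_baxter R \<longleftrightarrow>
     act2 1 2 R \<odot> act2 1 3 R \<odot> act2 2 3 R = act2 2 3 R \<odot> act2 1 3 R \<odot> act2 1 2 R"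

definition weight2 :: "nat \<Rightarrow> nat \<Rightarrow> 'n \<Rightarrow> 'n vect \<Rightarrow> 'n vect" where
  "weight2 a b i v x = basis_proj {a} (\<lambda>_. i) v x + basis_proj {b} (\<lambda>_. i) v x"

definition zero_weight :: "nat \<Rightarrow> nat \<Rightarrow> 'n dynop \<Rightarrow> bool" where
  "zero_weight a b X \<longleftrightarrow> (\<forall>i l. weight2 a b i \<circ> X l = X l \<circ> weight2 a b i)"

definition acts_only_in :: "nat set \<Rightarrow> 'n dynop \<Rightarrow> bool" where
  "acts_only_in S X \<longleftrightarrow> (\<exists>M. \<forall>l v x. X l v x =
     (\<Sum>y \<in> S \<rightarrow>\<^sub>E UNIV. M l (restrict x S) y * v (\<lambda>a. if a \<in> S then y a else x a)))"

definition pointwise :: "'n dynop \<Rightarrow> (complex ^ 'n \<Rightarrow> 'n vect) \<Rightarrow> complex ^ 'n \<Rightarrow> 'n vect" where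
  "pointwise X \<psi> l = X l (\<psi> l)"

definition exp_shift ::
  "complex \<Rightarrow> nat \<Rightarrow> (complex ^ 'n \<Rightarrow> 'n vect) \<Rightarrow> complex ^ 'n \<Rightarrow> 'n::finite vect" where
  "exp_shift \<gamma> a \<psi> l x = (\<Sum>i\<in>UNIV. basis_proj {a} (\<lambda>_. i) (\<psi> (l + \<gamma> *s eps i)) x)"


section \<open>The monodromy operator and the decoupling operator\<close>

definition A_op ::
  "(complex ^ 'n \<Rightarrow> 'n mat1) \<Rightarrow> (complex ^ 'n \<Rightarrow> 'n mat2) \<Rightarrow> nat \<Rightarrow> nat \<Rightarrow> 'n::finite dynop" where
  "A_op b R p q =
     dinv (act1 p b) \<odot> dinv (act1 q b) \<odot> act2 p q R \<odot> act1 p b \<odot> act1 q b"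

definition B_op ::
  "complex \<Rightarrow> (complex ^ 'n \<Rightarrow> 'n mat1) \<Rightarrow> nat \<Rightarrow> nat \<Rightarrow> 'n::finite dynop" where
  "B_op \<gamma> b p q = dinv (act1 q b) \<odot> shift \<gamma> {p} (act1 q b)"

definition C_op ::
  "complex \<Rightarrow> (complex ^ 'n \<Rightarrow> 'n mat1) \<Rightarrow> nat \<Rightarrow> nat \<Rightarrow> 'n::finite dynop" where
  "C_op \<gamma> b p q = dinv (act1 p b) \<odot> shift \<gamma> {q} (act1 p b)"

definition bk_mat ::
  "(complex ^ 'n \<Rightarrow> 'n mat1) \<Rightarrow> (complex ^ 'n \<Rightarrow> 'n mat1) \<Rightarrow> complex ^ 'n \<Rightarrow> 'n::finite mat1" where
  "bk_mat b k l = b l ** k l"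

definition D_op ::
  "complex \<Rightarrow> (complex ^ 'n \<Rightarrow> 'n mat1) \<Rightarrow> (complex ^ 'n \<Rightarrow> 'n mat1) \<Rightarrow>
   (complex ^ 'n \<Rightarrow> 'n mat2) \<Rightarrow> nat \<Rightarrow> nat \<Rightarrow> 'n::finite dynop" where
  "D_op \<gamma> b k R p q =
     dinv (shift \<gamma> {q} (act1 p (bk_mat b k))) \<odot> dinv (act1 q (bk_mat b k)) \<odot> act2 p q R \<odot>
     act1 p (bk_mat b k) \<odot> shift \<gamma> {p} (act1 q (bk_mat b k))"

definition k_tilde ::
  "(complex ^ 'n \<Rightarrow> 'n mat1) \<Rightarrow> (complex ^ 'n \<Rightarrow> 'n mat1) \<Rightarrow> (complex ^ 'n \<Rightarrow> 'n mat1) \<Rightarrow>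
   complex ^ 'n \<Rightarrow> 'n::finite mat1" where
  "k_tilde b Q k l = matrix_inv (b l) ** Q l ** b l ** k l"

text \<open>The spaces \<open>2m+1, 2m+3, \<dots>, 2N-1\<close> over which \<open>s_m\<close> sums; none if \<open>m = N\<close>.\<close>

definition s_spaces :: "nat \<Rightarrow> nat \<Rightarrow> nat set" where
  "s_spaces N m = (\<lambda>j. 2 * j + 1) ` {m..<N}"

definition monodromy ::
  "complex \<Rightarrow> (complex ^ 'n \<Rightarrow> 'n mat1) \<Rightarrow> (complex ^ 'n \<Rightarrow> 'n mat1) \<Rightarrow>
   (complex ^ 'n \<Rightarrow> 'n mat2) \<Rightarrow> (complex ^ 'n \<Rightarrow> 'n mat1) \<Rightarrow> (complex ^ 'n \<Rightarrow> 'n mat1) \<Rightarrow> nat \<Rightarrow>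
   (complex ^ 'n \<Rightarrow> 'n vect) \<Rightarrow> complex ^ 'n \<Rightarrow> 'n::finite vect" where
  "monodromy \<gamma> b k R Q chi N =
     pointwise
       (act1 0 (\<lambda>l. transpose (chi l)) \<odot>
        oprod (\<lambda>m. shift \<gamma> (s_spaces N m) (A_op b R 0 (2 * m)) \<odot>
                   shift \<gamma> (s_spaces N m) (C_op \<gamma> b 0 (2 * m - 1))) (rev [1..<N + 1]) \<odot>
        shift \<gamma> (s_spaces N 0) (act1 0 (k_tilde b Q k)) \<odot>
        oprod (\<lambda>m. shift \<gamma> (s_spaces N m) (D_op \<gamma> b k R 0 (2 * m - 1)) \<odot>
                   shift \<gamma> (s_spaces N m) (B_op \<gamma> b 0 (2 * m))) [1..<N + 1])
     \<circ> exp_shift \<gamma> 0"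

definition O_op ::
  "complex \<Rightarrow> (complex ^ 'n \<Rightarrow> 'n mat1) \<Rightarrow> (complex ^ 'n \<Rightarrow> 'n mat1) \<Rightarrow> nat \<Rightarrow>
   'n::finite dynop" where
  "O_op \<gamma> b k N =
     oprod (\<lambda>m. shift \<gamma> (s_spaces N m) (act1 (2 * m) b) \<odot>
                shift \<gamma> (s_spaces N m) (act1 (2 * m - 1) (bk_mat b k))) (rev [1..<N + 1])"

end

(*
  Write f_m = b_0(s_m), F_m = (bk)_0(s_m), B_m = b_{2m}(s_m), K_m = (bk)_{2m-1}(s_m), and let B'_m, K'_m
  be B_m, K_m with h_0 added to the shift. As h_{2m-1} + s_m = s_{m-1},
    A C = f_m^{-1} (B_m^{-1} R_{0,2m} B_m) f_{m-1},  D = F_{m-1}^{-1} K_m^{-1} R_{0,2m-1} F_m K'_m,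
    D B = D B_m^{-1} B'_m.
  The first product telescopes, and O_N = (K_N ... K_1)(B_N ... B_1) since B_m commutes with K_1, ..., K_m.
  Multiplying by O_N from the left, the B_m remove the conjugations and cancel the B_m^{-1}; then the
  K_m cancel the K_m^{-1} one after the other. The factors B'_m and K'_m with m < m' pass through
  D_{0,2m'-1}: their shift contains both spaces of D, which has zero weight. They end up on the right
  as O_N(h_0), and O_N(h_0) e^{gamma D_0} = e^{gamma D_0} O_N.
*)
theory Submission
  imports Defs
begin

section \<open>Substitution of the spectral parameters\<close>

text \<open>A dynamical shift is defined by a sum over projections, but on the component labelled
  \<open>x\<close> only one term survives. So every shifted factor becomes a matrix in its own space
  whose coefficients depend on the configuration, and two one-space factors commute as soon as
  neither space lies in the shift of the other. The hypothesis on the weight of D concerns the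
  spaces 1 and 2 and hence the variables u_1 and u_2, whereas the products contain D in the spaces 0
  and 2m-1. For this reason D is reduced to entries that know the labels only through the spectral
  variables, and the entries are carried over by renaming variables. Zero weight then says that a
  nonzero entry can only keep or exchange its two basis indices. An operator shifted by both spaces
  depends on their sum alone, and hence passes through D. An operator shifted by just one of the two
  spaces does not profit from this. That is why O_N is never moved through the D factors as a whole:
  inverses travel to the left to meet it, and factors with h_0 in the shift travel to the
  right.\<close>

lemma mfps_nth_in_var:
  "mfps_nth (in_var a f) m = (if set_mset m \<subseteq> {a} then fps_nth f (count m a) else 0)"
  by (simp add: in_var_def Abs_mfps_inverse)

lemma mfps_eqI: "(\<And>m. mfps_nth f m = mfps_nth g m) \<Longrightarrow> f = g"
  by (metis ext mfps_nth_inject)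

lemma in_var_0 [simp]: "in_var a 0 = 0"
  by (rule mfps_eqI) (simp add: mfps_nth_in_var zero_mfps.rep_eq)

lemma in_var_1 [simp]: "in_var a 1 = 1"
proof (rule mfps_eqI)
  fix m :: "nat multiset"
  have "m = {#}" if "set_mset m \<subseteq> {a}" "a \<notin># m"
    using that by (cases m) auto
  then show "mfps_nth (in_var a 1) m = mfps_nth 1 m"
    by (simp add: mfps_nth_in_var one_mfps.rep_eq count_eq_zero_iff)
qed

lemma in_var_add: "in_var a (f + g) = in_var a f + in_var a g"
  by (rule mfps_eqI) (simp add: mfps_nth_in_var plus_mfps.rep_eq)

lemma in_var_sum: "in_var a (sum f A) = (\<Sum>i\<in>A. in_var a (f i))"
  by (induction A rule: infinite_finite_induct) (auto simp: in_var_add)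

lemma divisors_replicate_mset: "{p. p \<subseteq># replicate_mset n a} = (\<lambda>i. replicate_mset i a) ` {..n}"
proof (intro equalityI subsetI)
  fix p assume "p \<in> {p. p \<subseteq># replicate_mset n a}"
  then have "p \<subseteq># replicate_mset n a" by simp
  then obtain i where "i \<le> n" "p = replicate_mset i a"
    by (rule msubseteq_replicate_msetE)
  then show "p \<in> (\<lambda>i. replicate_mset i a) ` {..n}" by simp
next
  fix p assume "p \<in> (\<lambda>i. replicate_mset i a) ` {..n}"
  then obtain i where "i \<le> n" "p = replicate_mset i a" by auto
  then show "p \<in> {p. p \<subseteq># replicate_mset n a}"
    by (simp add: subseteq_mset_def)
qed

text \<open>At a power of u_a the sum over submultisets is the Cauchy product. At a monomial with
  another variable, that variable stays in one factor of every factorization, so both sides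
  vanish.\<close>

lemma in_var_mult: "in_var a (f * g) = in_var a f * in_var a g"
proof -
  define F where "F h m = (if set_mset m \<subseteq> {a} then fps_nth h (count m a) else 0)"
    for h :: "complex fps" and m
  have "F (f * g) m = (\<Sum>p | p \<subseteq># m. F f p * F g (m - p))" for m
  proof (cases "set_mset m \<subseteq> {a}")
    case True
    then obtain n where m: "m = replicate_mset n a"
      by (metis set_mset_subset_singletonD)
    have inj: "inj_on (\<lambda>i. replicate_mset i a) {..n}"
      by (rule inj_onI) (metis size_replicate_mset)
    have "(\<Sum>p | p \<subseteq># m. F f p * F g (m - p)) =
        (\<Sum>i\<le>n. F f (replicate_mset i a) * F g (m - replicate_mset i a))"
      unfolding m divisors_replicate_mset by (subst sum.reindex[OF inj]) simp
    also have "\<dots> = (\<Sum>i\<le>n. fps_nth f i * fps_nth g (n - i))"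
      by (rule sum.cong) (auto simp: F_def m dest: in_diffD split: if_splits)
    finally show ?thesis
      by (simp add: F_def m fps_mult_nth atLeast0AtMost)
  next
    case False
    have "F f p * F g (m - p) = 0" if "p \<subseteq># m" for p
    proof -
      have "set_mset m = set_mset p \<union> set_mset (m - p)"
        using that by (metis set_mset_union subset_mset.add_diff_inverse)
      with False show ?thesis by (auto simp: F_def)
    qed
    then have "(\<Sum>p | p \<subseteq># m. F f p * F g (m - p)) = 0" by (intro sum.neutral) blast
    with False show ?thesis by (simp add: F_def)
  qed
  moreover have "in_var a h = Abs_mfps (F h)" for h
    unfolding in_var_def F_def ..
  ultimately show ?thesis
    by (intro mfps_eqI) (simp add: times_mfps.rep_eq Abs_mfps_inverse)
qed

section \<open>Renaming of the spectral variables\<close>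

definition rename_vars :: "(nat \<Rightarrow> nat) \<Rightarrow> complex mfps \<Rightarrow> complex mfps" where
  "rename_vars \<tau> f = Abs_mfps (\<lambda>m. mfps_nth f (image_mset \<tau> m))"

lemma rename_vars_0 [simp]: "rename_vars \<tau> 0 = 0"
  by (simp add: rename_vars_def zero_mfps_def Abs_mfps_inverse)

lemma rename_vars_add: "rename_vars \<tau> (f + g) = rename_vars \<tau> f + rename_vars \<tau> g"
  by (simp add: rename_vars_def plus_mfps_def Abs_mfps_inverse)

lemma rename_vars_sum: "rename_vars \<tau> (sum f A) = (\<Sum>i\<in>A. rename_vars \<tau> (f i))"
  by (induction A rule: infinite_finite_induct) (auto simp: rename_vars_add)

lemma inj_image_mset: assumes "inj f" shows "inj (image_mset f)"
proof (rule injI)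
  fix A B assume "image_mset f A = image_mset f B"
  then have "image_mset (inv f) (image_mset f A) = image_mset (inv f) (image_mset f B)" by simp
  then show "A = B" using assms by (simp add: multiset.map_comp)
qed

lemma divisors_image_mset:
  assumes "inj f"
  shows "{p. p \<subseteq># image_mset f m} = image_mset f ` {p. p \<subseteq># m}"
proof (intro equalityI subsetI)
  fix p assume "p \<in> {p. p \<subseteq># image_mset f m}"
  then have p: "p + (image_mset f m - p) = image_mset f m" by simp
  then obtain B C where "m = B + C" "p = image_mset f B"
    by (metis image_mset_eq_plusD)
  then show "p \<in> image_mset f ` {p. p \<subseteq># m}" by auto
qed (auto intro: image_mset_subseteq_mono)

text \<open>For an injective \<open>\<tau>\<close> the factorizations of a monomial correspond one
  to one to those of its image. In this case renaming turns u_(\<open>\<tau> a\<close>) into u_a and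
  sets the variables outside the range of \<open>\<tau>\<close> to zero.\<close>

lemma rename_vars_mult:
  assumes "inj \<tau>"
  shows "rename_vars \<tau> (f * g) = rename_vars \<tau> f * rename_vars \<tau> g"
proof -
  have "(\<Sum>p | p \<subseteq># image_mset \<tau> m. mfps_nth f p * mfps_nth g (image_mset \<tau> m - p)) =
    (\<Sum>p | p \<subseteq># m. mfps_nth f (image_mset \<tau> p) * mfps_nth g (image_mset \<tau> (m - p)))" for m
    unfolding divisors_image_mset[OF assms]
    by (subst sum.reindex) (auto simp: image_mset_Diff intro: inj_on_subset[OF inj_image_mset[OF assms]])
  then show ?thesis
    by (simp add: rename_vars_def times_mfps_def Abs_mfps_inverse)
qed

lemma count_image_mset_inj:
  assumes "inj f" shows "count (image_mset f m) (f a) = count m a"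
  by (induction m) (simp_all add: inj_eq[OF assms])

lemma rename_vars_in_var:
  assumes "inj \<tau>"
  shows "rename_vars \<tau> (in_var (\<tau> a) f) = in_var a f"
proof -
  have "set_mset (image_mset \<tau> m) \<subseteq> {\<tau> a} \<longleftrightarrow> set_mset m \<subseteq> {a}" for m
    by (auto simp: inj_eq[OF assms])
  then show ?thesis
    unfolding rename_vars_def in_var_def
    by (simp add: Abs_mfps_inverse count_image_mset_inj[OF assms] cong: if_cong)
qed

lemma rename_vars_in_vars:
  assumes "inj \<tau>"
  shows "rename_vars \<tau> (in_vars (\<tau> a) (\<tau> b) F) = in_vars a b F"
proof -
  have "set_mset (image_mset \<tau> m) \<subseteq> {\<tau> a, \<tau> b} \<longleftrightarrow> set_mset m \<subseteq> {a, b}" for m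
    by (auto simp: inj_eq[OF assms])
  then show ?thesis
    unfolding rename_vars_def in_vars_def
    by (simp add: Abs_mfps_inverse count_image_mset_inj[OF assms] cong: if_cong)
qed

text \<open>Weights of basis tensors such as e_i tensor e_i carry the multiplicity 2, which must not
  vanish when weights are compared.\<close>

lemma mfps_double_eq_0: "d + d = 0 \<Longrightarrow> d = 0" for d :: "complex mfps"
proof -
  assume "d + d = 0"
  then have "mfps_nth d m + mfps_nth d m = 0" for m
    by (metis plus_mfps.rep_eq zero_mfps.rep_eq)
  then show ?thesis
    by (simp add: mfps_nth_inject[symmetric] zero_mfps.rep_eq fun_eq_iff)
qed

lemma ex_inj_two_values:
  fixes p q c d :: 'a
  assumes "p \<noteq> q" "c \<noteq> d"
  shows "\<exists>f. inj f \<and> f p = c \<and> f q = d"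
proof (intro exI conjI)
  \<comment> \<open>The inner transposition sends \<open>p\<close> to \<open>c\<close>. The outer
    one sends the resulting image of \<open>q\<close> to \<open>d\<close> and fixes
    \<open>c\<close>, which differs from both of its points.\<close>
  let ?f = "Transposition.transpose (Transposition.transpose p c q) d \<circ> Transposition.transpose p c"
  show "inj ?f" by (simp add: inj_compose)
  show "?f p = c" "?f q = d" using assms by (auto simp: Transposition.transpose_def)
qed

section \<open>Operators on one and two tensor factors\<close>

text \<open>The coefficients may depend on the whole configuration, which is what absorbs dynamical
  shifts by other spaces.\<close>

definition lin1 :: "nat \<Rightarrow> ((nat \<Rightarrow> 'n) \<Rightarrow> 'n \<Rightarrow> complex mfps) \<Rightarrow> 'n::finite vect \<Rightarrow> 'n vect" where
  "lin1 a c v x = (\<Sum>j\<in>UNIV. c x j * v (x(a := j)))"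

definition lin2 ::
  "nat \<Rightarrow> nat \<Rightarrow> ((nat \<Rightarrow> 'n) \<Rightarrow> 'n \<Rightarrow> 'n \<Rightarrow> complex mfps) \<Rightarrow> 'n::finite vect \<Rightarrow> 'n vect" where
  "lin2 a b c v x = (\<Sum>j\<in>UNIV. \<Sum>j'\<in>UNIV. c x j j' * v (x(a := j, b := j')))"

lemma lin1_comp:
  "lin1 a c \<circ> lin1 a d = lin1 a (\<lambda>x k. \<Sum>j\<in>UNIV. c x j * d (x(a := j)) k)"
proof (intro ext)
  fix v x
  have "(lin1 a c \<circ> lin1 a d) v x =
      (\<Sum>j\<in>UNIV. \<Sum>k\<in>UNIV. c x j * d (x(a := j)) k * v (x(a := k)))"
    by (simp add: lin1_def sum_distrib_left mult.assoc)
  also have "\<dots> = (\<Sum>k\<in>UNIV. \<Sum>j\<in>UNIV. c x j * d (x(a := j)) k * v (x(a := k)))"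
    by (rule sum.swap)
  finally show "(lin1 a c \<circ> lin1 a d) v x =
      lin1 a (\<lambda>x k. \<Sum>j\<in>UNIV. c x j * d (x(a := j)) k) v x"
    by (simp add: lin1_def sum_distrib_right)
qed

lemma lin1_commute:
  assumes "a \<noteq> b" and c: "\<And>x j. c (x(b := j)) = c x" and d: "\<And>x j. d (x(a := j)) = d x"
  shows "lin1 a c \<circ> lin1 b d = lin1 b d \<circ> lin1 a c"
proof (intro ext)
  fix v x
  have "(lin1 a c \<circ> lin1 b d) v x =
      (\<Sum>j\<in>UNIV. \<Sum>k\<in>UNIV. c x j * (d x k * v (x(a := j, b := k))))"
    by (simp add: lin1_def sum_distrib_left d)
  also have "\<dots> = (\<Sum>k\<in>UNIV. \<Sum>j\<in>UNIV. c x j * (d x k * v (x(a := j, b := k))))"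
    by (rule sum.swap)
  also have "\<dots> = (lin1 b d \<circ> lin1 a c) v x"
    using \<open>a \<noteq> b\<close> by (simp add: lin1_def sum_distrib_left c fun_upd_twist mult.left_commute)
  finally show "(lin1 a c \<circ> lin1 b d) v x = (lin1 b d \<circ> lin1 a c) v x" .
qed

text \<open>The coefficients of the one-space factor have to be stable only along nonzero entries of
  \<open>c\<close>. This weak condition is what zero weight delivers when the shift of that factor
  contains \<open>a\<close> and \<open>b\<close>.\<close>

lemma lin1_lin2_commute:
  assumes "e \<noteq> a" "e \<noteq> b" and c: "\<And>x j. c (x(e := j)) = c x"
    and d: "\<And>x j j'. c x j j' \<noteq> 0 \<Longrightarrow> d (x(a := j, b := j')) = d x"
  shows "lin1 e d \<circ> lin2 a b c = lin2 a b c \<circ> lin1 e d"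
proof (intro ext)
  fix v x
  have d': "c x j j' * (d (x(a := j, b := j')) k * t) = c x j j' * (d x k * t)" for j j' k t
    by (cases "c x j j' = 0") (simp_all add: d)
  have "(lin2 a b c \<circ> lin1 e d) v x =
      (\<Sum>j\<in>UNIV. \<Sum>j'\<in>UNIV. \<Sum>k\<in>UNIV. c x j j' * (d x k * v (x(a := j, b := j', e := k))))"
    by (simp add: lin1_def lin2_def sum_distrib_left d')
  also have "\<dots> =
      (\<Sum>j\<in>UNIV. \<Sum>k\<in>UNIV. \<Sum>j'\<in>UNIV. c x j j' * (d x k * v (x(a := j, b := j', e := k))))"
    by (intro sum.cong sum.swap refl)
  also have "\<dots> =
      (\<Sum>k\<in>UNIV. \<Sum>j\<in>UNIV. \<Sum>j'\<in>UNIV. c x j j' * (d x k * v (x(a := j, b := j', e := k))))"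
    by (rule sum.swap)
  also have "\<dots> = (lin1 e d \<circ> lin2 a b c) v x"
  proof -
    have "x(a := j, b := j', e := k) = x(e := k, a := j, b := j')" for j j' k
      using assms(1,2) by auto
    then show ?thesis
      by (simp add: lin1_def lin2_def sum_distrib_left c mult.left_commute)
  qed
  finally show "(lin1 e d \<circ> lin2 a b c) v x = (lin2 a b c \<circ> lin1 e d) v x" by simp
qed

section \<open>Algebra of dynamical operators\<close>

lemma dmult_assoc: "(X \<odot> Y) \<odot> Z = X \<odot> (Y \<odot> Z)"
  by (simp add: dmult_def fun_eq_iff)

definition ident :: "'n dynop" where
  "ident l = id"

lemma dmult_id [simp]: "X \<odot> ident = X" "ident \<odot> X = X"
  by (simp_all add: dmult_def ident_def fun_eq_iff)

lemma dinv_unique: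
  assumes "X \<odot> Y = ident" "Y \<odot> X = ident"
  shows "dinv X = Y"
proof
  fix l
  have "X l \<circ> Y l = id" "Y l \<circ> X l = id"
    using assms by (metis dmult_def ident_def)+
  then show "dinv X l = Y l"
    unfolding dinv_def by (metis inv_unique_comp)
qed

section \<open>Dynamical shifts\<close>

text \<open>The h_a are diagonal; this is the amount by which lambda moves on the basis tensor
  labelled \<open>x\<close>.\<close>

definition wt :: "complex \<Rightarrow> nat set \<Rightarrow> (nat \<Rightarrow> 'n) \<Rightarrow> complex ^ 'n::finite" where
  "wt \<gamma> S x = (\<Sum>a\<in>S. \<gamma> *s eps (x a))"

lemma wt_empty [simp]: "wt \<gamma> {} x = 0"
  by (simp add: wt_def)

lemma wt_upd [simp]: "c \<notin> S \<Longrightarrow> wt \<gamma> S (x(c := j)) = wt \<gamma> S x"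
  unfolding wt_def by (rule sum.cong) auto

lemma wt_Un: "finite S \<Longrightarrow> finite S' \<Longrightarrow> S \<inter> S' = {} \<Longrightarrow> wt \<gamma> (S \<union> S') x = wt \<gamma> S x + wt \<gamma> S' x"
  unfolding wt_def by (rule sum.union_disjoint)

lemma non_dynamical_wt: "non_dynamical \<gamma> X \<Longrightarrow> finite S \<Longrightarrow> X (l + wt \<gamma> S x) = X l"
proof (induction S arbitrary: l rule: infinite_finite_induct)
  case (insert a S)
  have "l + wt \<gamma> (insert a S) x = (l + wt \<gamma> S x) + \<gamma> *s eps (x a)"
    using insert by (simp add: wt_def)
  then have "X (l + wt \<gamma> (insert a S) x) = X ((l + wt \<gamma> S x) + \<gamma> *s eps (x a))"
    by (simp add: add.assoc)
  also have "\<dots> = X (l + wt \<gamma> S x)"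
    using insert.prems(1) unfolding non_dynamical_def by blast
  finally show ?case using insert by simp
qed auto

text \<open>\<open>sact1 \<gamma> S a X\<close> is \<open>X_a(h_S)\<close>: the matrix \<open>X\<close> in space \<open>a\<close>, shifted by the spaces in \<open>S\<close>.\<close>

definition sact1 ::
  "complex \<Rightarrow> nat set \<Rightarrow> nat \<Rightarrow> (complex ^ 'n \<Rightarrow> 'n mat1) \<Rightarrow> 'n::finite dynop" where
  "sact1 \<gamma> S a X l = lin1 a (\<lambda>x j. in_var a (X (l + wt \<gamma> S x) $ x a $ j))"

lemma act1_eq_sact1: "act1 a X = sact1 \<gamma> {} a X"
  by (simp add: fun_eq_iff act1_def sact1_def lin1_def)

lemma act2_eq_lin2: "act2 a b X l = lin2 a b (\<lambda>x j j'. in_vars a b (X l $ (x a, x b) $ (j, j')))"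
  by (simp add: fun_eq_iff act2_def lin2_def)

lemma sact1_mult:
  assumes "a \<notin> S"
  shows "sact1 \<gamma> S a X \<odot> sact1 \<gamma> S a Y = sact1 \<gamma> S a (\<lambda>l. X l ** Y l)"
  using assms
  by (simp add: fun_eq_iff dmult_def sact1_def lin1_comp[unfolded fun_eq_iff, simplified]
      matrix_matrix_mult_def in_var_sum in_var_mult)

lemma sact1_one: "sact1 \<gamma> S a (\<lambda>l. mat 1) = ident"
proof (intro ext)
  fix l :: "complex ^ 'n" and v :: "'n vect" and x :: "nat \<Rightarrow> 'n"
  have "in_var a ((mat 1 :: 'n mat1) $ x a $ j) * v (x(a := j)) = (if x a = j then v x else 0)" for j
    by (auto simp: mat_def fun_upd_idem)
  then show "sact1 \<gamma> S a (\<lambda>l. mat 1) l v x = ident l v x"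
    by (simp add: sact1_def lin1_def ident_def)
qed

lemma matrix_inv_inverse:
  assumes "invertible A"
  shows "A ** matrix_inv A = mat 1 \<and> matrix_inv A ** A = mat 1"
  using assms unfolding invertible_def matrix_inv_def by (rule someI_ex)

lemma sact1_inverse:
  assumes "a \<notin> S" "\<And>l. invertible (X l)"
  shows "sact1 \<gamma> S a X \<odot> sact1 \<gamma> S a (\<lambda>l. matrix_inv (X l)) = ident"
    and "sact1 \<gamma> S a (\<lambda>l. matrix_inv (X l)) \<odot> sact1 \<gamma> S a X = ident"
  using assms by (simp_all add: sact1_mult matrix_inv_inverse sact1_one)

lemma dinv_sact1:
  assumes "a \<notin> S" "\<And>l. invertible (X l)"
  shows "dinv (sact1 \<gamma> S a X) = sact1 \<gamma> S a (\<lambda>l. matrix_inv (X l))"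
  using assms by (intro dinv_unique sact1_inverse)

lemma sact1_commute:
  assumes "a \<noteq> a'" "a \<notin> S'" "a' \<notin> S"
  shows "sact1 \<gamma> S a X \<odot> sact1 \<gamma> S' a' Y = sact1 \<gamma> S' a' Y \<odot> sact1 \<gamma> S a X"
  unfolding dmult_def sact1_def
  by (intro ext lin1_commute[unfolded fun_eq_iff, rule_format]) (use assms in auto)

lemma sact1_act2_commute:
  assumes "a \<noteq> p" "a \<noteq> q" "p \<notin> S" "q \<notin> S"
  shows "sact1 \<gamma> S a X \<odot> act2 p q R = act2 p q R \<odot> sact1 \<gamma> S a X"
  unfolding dmult_def sact1_def act2_eq_lin2
  by (intro ext lin1_lin2_commute[unfolded fun_eq_iff, rule_format]) (use assms in auto)

text \<open>Weaker than \<open>acts_only_in\<close>: only the arguments of \<open>v\<close> are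
  confined to changes in \<open>T\<close>, while the coefficients may depend on every space, as they
  do for shifted matrices. Preservation of zero stands in for linearity, to deal with the vectors
  that a projection kills.\<close>

definition local_op :: "nat set \<Rightarrow> 'n dynop \<Rightarrow> bool" where
  "local_op T f \<longleftrightarrow> (\<forall>l x. f l (\<lambda>_. 0) x = 0) \<and>
     (\<forall>l v w x. (\<forall>y. (\<forall>a. a \<notin> T \<longrightarrow> y a = x a) \<longrightarrow> v y = w y) \<longrightarrow> f l v x = f l w x)"

lemma local_opD:
  assumes "local_op T f" "\<And>y. (\<And>a. a \<notin> T \<Longrightarrow> y a = x a) \<Longrightarrow> v y = w y"
  shows "f l v x = f l w x"
  using assms unfolding local_op_def by blast

lemma local_op_zero: "local_op T f \<Longrightarrow> f l (\<lambda>_. 0) = (\<lambda>_. 0)"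
  by (auto simp: local_op_def)

lemma local_op_dmult:
  assumes f: "local_op T f" and g: "local_op T g"
  shows "local_op T (f \<odot> g)"
  unfolding local_op_def dmult_def
proof (intro conjI allI impI)
  fix l and v w :: "'a vect" and x
  assume vw: "\<forall>y. (\<forall>a. a \<notin> T \<longrightarrow> y a = x a) \<longrightarrow> v y = w y"
  have "f l (g l v) x = f l (g l w) x"
  proof (rule local_opD[OF f])
    fix y assume y: "\<And>a. a \<notin> T \<Longrightarrow> y a = x a"
    show "g l v y = g l w y"
      using vw y by (intro local_opD[OF g]) auto
  qed
  then show "(f l \<circ> g l) v x = (f l \<circ> g l) w x" by simp
qed (simp add: local_op_zero[OF f] local_op_zero[OF g])

lemma shift_local:
  assumes f: "local_op T f" and "finite S" "S \<inter> T = {}"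
  shows "shift \<gamma> S f l v x = f (l + wt \<gamma> S x) v x"
proof -
  \<comment> \<open>\<open>f\<close> inspects only configurations that agree with \<open>x\<close>
    on \<open>S\<close>; on these the projection either keeps \<open>v\<close> or annihilates
    it.\<close>
  have eq: "f l' (basis_proj S i v) x = (if i = restrict x S then f l' v x else 0)"
    if i: "i \<in> S \<rightarrow>\<^sub>E UNIV" for i l'
  proof (cases "i = restrict x S")
    case True
    have "f l' (basis_proj S i v) x = f l' v x"
      using f by (rule local_opD) (use True assms(3) in \<open>auto simp: basis_proj_def\<close>)
    then show ?thesis using True by simp
  next
    case False
    obtain a where a: "a \<in> S" "i a \<noteq> x a"
    proof (rule ccontr)
      assume "\<not> thesis"
      then have "i a = restrict x S a" for a
        using i by (cases "a \<in> S") (auto simp: PiE_def extensional_def intro: that)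
      then show False using False by blast
    qed
    have "f l' (basis_proj S i v) x = f l' (\<lambda>_. 0) x"
    proof (rule local_opD[OF f])
      fix y assume "\<And>a. a \<notin> T \<Longrightarrow> y a = x a"
      then have "y a = x a" using a assms(3) by blast
      then show "basis_proj S i v y = 0" using a by (auto simp: basis_proj_def)
    qed
    then show ?thesis using False f by (simp add: local_op_zero)
  qed
  have "shift \<gamma> S f l v x =
      (\<Sum>i \<in> S \<rightarrow>\<^sub>E UNIV. if i = restrict x S then f (l + wt \<gamma> S x) v x else 0)"
    unfolding shift_def
    by (rule sum.cong) (auto simp: eq wt_def)
  also have "\<dots> = f (l + wt \<gamma> S x) v x"
    using \<open>finite S\<close> by (simp add: sum.delta finite_PiE)
  finally show ?thesis .
qed

text \<open>\<open>f\<close> changes labels in \<open>T\<close> only, so the inner operator still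
  sees the shift vector that belongs to \<open>x\<close>.\<close>

lemma shift_dmult:
  assumes f: "local_op T f" and g: "local_op T g" and "finite S" "S \<inter> T = {}"
  shows "shift \<gamma> S (f \<odot> g) = shift \<gamma> S f \<odot> shift \<gamma> S g"
proof (intro ext)
  fix l v and x :: "nat \<Rightarrow> 'a"
  have wt: "wt \<gamma> S y = wt \<gamma> S x" if "\<And>a. a \<notin> T \<Longrightarrow> y a = x a" for y
    unfolding wt_def
  proof (rule sum.cong[OF refl])
    fix a assume "a \<in> S"
    then have "y a = x a" using that assms(4) by blast
    then show "\<gamma> *s eps (y a) = \<gamma> *s eps (x a)" by simp
  qed
  have "shift \<gamma> S (f \<odot> g) l v x = f (l + wt \<gamma> S x) (g (l + wt \<gamma> S x) v) x"
    using local_op_dmult[OF f g] assms(3,4) by (simp add: shift_local) (simp add: dmult_def)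
  also have "\<dots> = f (l + wt \<gamma> S x) (\<lambda>y. g (l + wt \<gamma> S y) v y) x"
  proof (rule local_opD[OF f])
    fix y assume "\<And>a. a \<notin> T \<Longrightarrow> y a = x a"
    then have "wt \<gamma> S y = wt \<gamma> S x" by (rule wt)
    then show "g (l + wt \<gamma> S x) v y = g (l + wt \<gamma> S y) v y" by simp
  qed
  also have "\<dots> = (shift \<gamma> S f \<odot> shift \<gamma> S g) l v x"
  proof -
    have "shift \<gamma> S g l v = (\<lambda>y. g (l + wt \<gamma> S y) v y)"
      by (rule ext) (rule shift_local[OF g assms(3,4)])
    then show ?thesis by (simp add: dmult_def shift_local[OF f assms(3,4)])
  qed
  finally show "shift \<gamma> S (f \<odot> g) l v x = (shift \<gamma> S f \<odot> shift \<gamma> S g) l v x" .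
qed

lemma local_op_lin1:
  assumes "a \<in> T" shows "local_op T (\<lambda>l. lin1 a (c l))"
  unfolding local_op_def lin1_def
proof (intro conjI allI impI)
  fix l and v w :: "'a vect" and x
  assume "\<forall>y. (\<forall>a. a \<notin> T \<longrightarrow> y a = x a) \<longrightarrow> v y = w y"
  then have "v (x(a := j)) = w (x(a := j))" for j
    using assms by auto
  then show "(\<Sum>j\<in>UNIV. c l x j * v (x(a := j))) = (\<Sum>j\<in>UNIV. c l x j * w (x(a := j)))"
    by simp
qed simp

lemma local_op_lin2:
  assumes "a \<in> T" "b \<in> T" shows "local_op T (\<lambda>l. lin2 a b (c l))"
  unfolding local_op_def lin2_def
proof (intro conjI allI impI)
  fix l and v w :: "'a vect" and x
  assume "\<forall>y. (\<forall>a. a \<notin> T \<longrightarrow> y a = x a) \<longrightarrow> v y = w y"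
  then have "v (x(a := j, b := j')) = w (x(a := j, b := j'))" for j j'
    using assms by auto
  then show "(\<Sum>j\<in>UNIV. \<Sum>j'\<in>UNIV. c l x j j' * v (x(a := j, b := j'))) =
      (\<Sum>j\<in>UNIV. \<Sum>j'\<in>UNIV. c l x j j' * w (x(a := j, b := j')))" by simp
qed simp

lemma local_op_sact1: "a \<in> T \<Longrightarrow> local_op T (sact1 \<gamma> S a X)"
  unfolding sact1_def by (rule local_op_lin1)

lemma local_op_act2: "a \<in> T \<Longrightarrow> b \<in> T \<Longrightarrow> local_op T (act2 a b X)"
  using local_op_lin2[of a T b "\<lambda>l x j j'. in_vars a b (X l $ (x a, x b) $ (j, j'))"]
  by (simp add: act2_eq_lin2[symmetric])

lemma shift_sact1:
  assumes "finite S" "finite S'" "S \<inter> S' = {}" "a \<notin> S"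
  shows "shift \<gamma> S (sact1 \<gamma> S' a X) = sact1 \<gamma> (S \<union> S') a X"
  using assms
  by (simp add: fun_eq_iff shift_local[OF local_op_sact1[of a "{a}"]] sact1_def lin1_def wt_Un
      add.assoc)

lemma shift_act1:
  assumes "finite S" "a \<notin> S"
  shows "shift \<gamma> S (act1 a X) = sact1 \<gamma> S a X"
  using assms by (simp add: act1_eq_sact1[of _ _ \<gamma>] shift_sact1)

lemma shift_act2:
  assumes "finite S" "a \<notin> S" "b \<notin> S" "non_dynamical \<gamma> X"
  shows "shift \<gamma> S (act2 a b X) = act2 a b X"
  using assms
  by (simp add: fun_eq_iff shift_local[OF local_op_act2[of a "{a, b}"]] act2_def non_dynamical_wt)

lemma sact1_non_dynamical:
  assumes "finite S" "non_dynamical \<gamma> X"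
  shows "sact1 \<gamma> S a X = act1 a X"
  using assms by (simp add: fun_eq_iff sact1_def act1_def lin1_def non_dynamical_wt)

section \<open>The matrix elements of \<open>D\<close>\<close>

text \<open>The product in End(V) tensor End(V), written for entries indexed by basis elements and
  thus free of space labels.\<close>

definition kmult ::
  "('n \<Rightarrow> 'n \<Rightarrow> 'n \<Rightarrow> 'n \<Rightarrow> complex mfps) \<Rightarrow> ('n \<Rightarrow> 'n \<Rightarrow> 'n \<Rightarrow> 'n \<Rightarrow> complex mfps) \<Rightarrow>
   'n::finite \<Rightarrow> 'n \<Rightarrow> 'n \<Rightarrow> 'n \<Rightarrow> complex mfps" where
  "kmult c d i i' k k' = (\<Sum>j\<in>UNIV. \<Sum>j'\<in>UNIV. c i i' j j' * d j j' k k')"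

lemma lin2_kmult:
  assumes "p \<noteq> q"
  shows "lin2 p q (\<lambda>x. c (x p) (x q)) \<circ> lin2 p q (\<lambda>x. d (x p) (x q)) =
    lin2 p q (\<lambda>x. kmult c d (x p) (x q))"
proof (intro ext)
  fix v x
  define t where "t j j' k k' = c (x p) (x q) j j' * d j j' k k' * v (x(p := k, q := k'))" for j j' k k'
  have upd: "x(p := j, q := j', p := k, q := k') = x(p := k, q := k')" for j j' k k'
    using assms by auto
  have "(lin2 p q (\<lambda>x. c (x p) (x q)) \<circ> lin2 p q (\<lambda>x. d (x p) (x q))) v x =
      (\<Sum>(j, j')\<in>UNIV \<times> UNIV. \<Sum>(k, k')\<in>UNIV \<times> UNIV. t j j' k k')"
    using assms
    by (simp add: lin2_def sum_distrib_left mult.assoc t_def upd sum.cartesian_product[symmetric]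
        del: UNIV_Times_UNIV)
  also have "\<dots> = (\<Sum>(k, k')\<in>UNIV \<times> UNIV. \<Sum>(j, j')\<in>UNIV \<times> UNIV. t j j' k k')"
    unfolding case_prod_unfold by (rule sum.swap)
  also have "\<dots> = lin2 p q (\<lambda>x. kmult c d (x p) (x q)) v x"
    by (simp add: lin2_def kmult_def sum_distrib_right t_def sum.cartesian_product[symmetric]
        del: UNIV_Times_UNIV)
  finally show "(lin2 p q (\<lambda>x. c (x p) (x q)) \<circ> lin2 p q (\<lambda>x. d (x p) (x q))) v x =
    lin2 p q (\<lambda>x. kmult c d (x p) (x q)) v x" .
qed

lemma rename_vars_kmult:
  assumes "inj \<tau>"
    and "\<And>i i' j j'. rename_vars \<tau> (c i i' j j') = c' i i' j j'"
    and "\<And>i i' j j'. rename_vars \<tau> (d i i' j j') = d' i i' j j'"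
  shows "rename_vars \<tau> (kmult c d i i' j j') = kmult c' d' i i' j j'"
  using assms by (simp add: kmult_def rename_vars_sum rename_vars_mult)

text \<open>\<open>X\<close> is indexed by the basis element in the other factor, where the operator
  is diagonal: this is a matrix shifted by the other space. A constant \<open>X\<close> gives an
  unshifted matrix.\<close>

definition kfst :: "nat \<Rightarrow> ('n \<Rightarrow> 'n mat1) \<Rightarrow> 'n::finite \<Rightarrow> 'n \<Rightarrow> 'n \<Rightarrow> 'n \<Rightarrow> complex mfps" where
  "kfst p X i i' j j' = (if j' = i' then in_var p (X i' $ i $ j) else 0)"

definition ksnd :: "nat \<Rightarrow> ('n \<Rightarrow> 'n mat1) \<Rightarrow> 'n::finite \<Rightarrow> 'n \<Rightarrow> 'n \<Rightarrow> 'n \<Rightarrow> complex mfps" where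
  "ksnd q X i i' j j' = (if j = i then in_var q (X i $ i' $ j') else 0)"

lemma lin1_eq_kfst:
  assumes "p \<noteq> q"
  shows "lin1 p (\<lambda>x j. in_var p (X (x q) $ x p $ j)) = lin2 p q (\<lambda>x. kfst p X (x p) (x q))"
proof (intro ext)
  fix v x
  have "(\<Sum>j'\<in>UNIV. kfst p X (x p) (x q) j j' * v (x(p := j, q := j'))) =
      in_var p (X (x q) $ x p $ j) * v (x(p := j))" for j
  proof -
    have "(\<Sum>j'\<in>UNIV. kfst p X (x p) (x q) j j' * v (x(p := j, q := j'))) =
      (\<Sum>j'\<in>UNIV. if j' = x q then in_var p (X (x q) $ x p $ j) * v (x(p := j)) else 0)"
      using assms by (intro sum.cong) (auto simp: kfst_def fun_upd_idem)
    then show ?thesis by simp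
  qed
  then show "lin1 p (\<lambda>x j. in_var p (X (x q) $ x p $ j)) v x =
      lin2 p q (\<lambda>x. kfst p X (x p) (x q)) v x"
    by (simp add: lin1_def lin2_def)
qed

lemma lin1_eq_ksnd:
  assumes "p \<noteq> q"
  shows "lin1 q (\<lambda>x j. in_var q (X (x p) $ x q $ j)) = lin2 p q (\<lambda>x. ksnd q X (x p) (x q))"
proof (intro ext)
  fix v x
  have "(\<Sum>j'\<in>UNIV. ksnd q X (x p) (x q) j j' * v (x(p := j, q := j'))) =
      (if j = x p then \<Sum>j'\<in>UNIV. in_var q (X (x p) $ x q $ j') * v (x(q := j')) else 0)" for j
    by (auto simp: ksnd_def fun_upd_idem)
  then show "lin1 q (\<lambda>x j. in_var q (X (x p) $ x q $ j)) v x =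
      lin2 p q (\<lambda>x. ksnd q X (x p) (x q)) v x"
    by (simp add: lin1_def lin2_def)
qed

definition Dker ::
  "complex \<Rightarrow> (complex ^ 'n \<Rightarrow> 'n mat1) \<Rightarrow> (complex ^ 'n \<Rightarrow> 'n mat2) \<Rightarrow> nat \<Rightarrow> nat \<Rightarrow>
   complex ^ 'n \<Rightarrow> 'n::finite \<Rightarrow> 'n \<Rightarrow> 'n \<Rightarrow> 'n \<Rightarrow> complex mfps" where
  "Dker \<gamma> G R p q l =
     kmult (kmult (kmult (kmult
       (kfst p (\<lambda>i. matrix_inv (G (l + \<gamma> *s eps i))))
       (ksnd q (\<lambda>_. matrix_inv (G l))))
       (\<lambda>i i' j j'. in_vars p q (R l $ (i, i') $ (j, j'))))
       (kfst p (\<lambda>_. G l)))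
       (ksnd q (\<lambda>i. G (l + \<gamma> *s eps i)))"

text \<open>The labels enter only through u_p and u_q; all else is sums and products, which an
  injective renaming respects.\<close>

lemma rename_vars_Dker:
  assumes "inj \<tau>"
  shows "rename_vars \<tau> (Dker \<gamma> G R (\<tau> p) (\<tau> q) l i i' j j') = Dker \<gamma> G R p q l i i' j j'"
  unfolding Dker_def
  by (intro rename_vars_kmult assms)
    (auto simp: kfst_def ksnd_def rename_vars_in_var[OF assms] rename_vars_in_vars[OF assms])

lemma bk_mat_invertible:
  assumes "\<And>l. invertible (b l)" "\<And>l. invertible (k l)"
  shows "invertible (bk_mat b k l)"
  using assms by (simp add: bk_mat_def invertible_mult)

lemma D_op_eq:
  assumes "p \<noteq> q" and G: "\<And>l. invertible (bk_mat b k l)"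
  shows "D_op \<gamma> b k R p q =
    sact1 \<gamma> {q} p (\<lambda>l. matrix_inv (bk_mat b k l)) \<odot> act1 q (\<lambda>l. matrix_inv (bk_mat b k l)) \<odot>
    act2 p q R \<odot> act1 p (bk_mat b k) \<odot> sact1 \<gamma> {p} q (bk_mat b k)"
  using assms
  by (simp add: D_op_def shift_act1 dinv_sact1 act1_eq_sact1[of _ _ \<gamma>] shift_sact1)

lemma D_op_kernel:
  assumes "p \<noteq> q" "\<And>l. invertible (bk_mat b k l)"
  shows "D_op \<gamma> b k R p q l = lin2 p q (\<lambda>x. Dker \<gamma> (bk_mat b k) R p q l (x p) (x q))"
proof -
  define r where "r = (\<lambda>i i' j j'. in_vars p q (R l $ (i, i') $ (j, j')))"
  let ?G = "bk_mat b k" and ?H = "\<lambda>l. matrix_inv (bk_mat b k l)"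
  have "sact1 \<gamma> {q} p ?H l = lin2 p q (\<lambda>x. kfst p (\<lambda>i. ?H (l + \<gamma> *s eps i)) (x p) (x q))"
    unfolding lin1_eq_kfst[OF assms(1), symmetric] by (simp add: sact1_def wt_def)
  moreover have "act1 q ?H l = lin2 p q (\<lambda>x. ksnd q (\<lambda>_. ?H l) (x p) (x q))"
    unfolding lin1_eq_ksnd[OF assms(1), symmetric] by (simp add: act1_eq_sact1[of _ _ \<gamma>] sact1_def)
  moreover have "act1 p ?G l = lin2 p q (\<lambda>x. kfst p (\<lambda>_. ?G l) (x p) (x q))"
    unfolding lin1_eq_kfst[OF assms(1), symmetric] by (simp add: act1_eq_sact1[of _ _ \<gamma>] sact1_def)
  moreover have "sact1 \<gamma> {p} q ?G l = lin2 p q (\<lambda>x. ksnd q (\<lambda>i. ?G (l + \<gamma> *s eps i)) (x p) (x q))"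
    unfolding lin1_eq_ksnd[OF assms(1), symmetric] by (simp add: sact1_def wt_def)
  moreover have "act2 p q R l = lin2 p q (\<lambda>x. r (x p) (x q))"
    by (simp add: act2_eq_lin2 r_def)
  ultimately show ?thesis
    unfolding D_op_eq[OF assms] dmult_def Dker_def r_def[symmetric]
    by (simp only: lin2_kmult[OF assms(1)])
qed

text \<open>Applying D to e_j tensor e_j' and comparing weights shows that, after multiplication by
  the entry, every basis index has the same multiplicity in (i, i') as in (j, j').\<close>

lemma zero_weight_Dker_12:
  assumes G: "\<And>l. invertible (bk_mat b k l)"
    and zw: "zero_weight 1 2 (D_op \<gamma> b k R 1 2)"
    and nz: "Dker \<gamma> (bk_mat b k) R 1 2 l i i' j j' \<noteq> 0"
  shows "(i = j \<and> i' = j') \<or> (i = j' \<and> i' = j)"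
proof -
  define d where "d = Dker \<gamma> (bk_mat b k) R 1 2 l i i' j j'"
  define v :: "'a vect" where "v y = (if y 1 = j \<and> y 2 = j' then 1 else 0)" for y
  define x where "x = (\<lambda>a :: nat. if a = 1 then i else i')"
  define c where "c r s t = (if r = t then d else 0) + (if s = t then d else 0)" for r s t :: 'a
  have D: "D_op \<gamma> b k R 1 2 l w x =
      (\<Sum>r\<in>UNIV. \<Sum>s\<in>UNIV. Dker \<gamma> (bk_mat b k) R 1 2 l i i' r s * w (x(1 := r, 2 := s)))" for w
    using D_op_kernel[OF _ G, of 1 2] by (simp add: lin2_def x_def)
  have sum1: "(\<Sum>r\<in>UNIV. \<Sum>s\<in>UNIV. Dker \<gamma> (bk_mat b k) R 1 2 l i i' r s *
      (if r = j \<and> s = j' then z else 0)) = d * z" for z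
  proof -
    have "(\<Sum>s\<in>UNIV. Dker \<gamma> (bk_mat b k) R 1 2 l i i' r s * (if r = j \<and> s = j' then z else 0)) =
        (if r = j then d * z else 0)" for r
      by (auto simp: d_def if_distrib cong: if_cong)
    then show ?thesis by simp
  qed
  have Dv: "D_op \<gamma> b k R 1 2 l v x = d"
    unfolding D using sum1[of 1] by (simp add: v_def cong: if_cong)
  \<comment> \<open>\<open>c r s t\<close> is the entry \<open>d\<close> times the multiplicity of
    \<open>t\<close> in the pair (r, s).\<close>
  have "c i i' t = c j j' t" for t
  proof -
    have "weight2 1 2 t v (x(1 := r, 2 := s)) =
      (if r = j \<and> s = j' then (if j = t then 1 else 0) + (if j' = t then 1 else 0) else 0)" for r s
      by (auto simp: weight2_def basis_proj_def v_def)
    then have "D_op \<gamma> b k R 1 2 l (weight2 1 2 t v) x =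
        d * ((if j = t then 1 else 0) + (if j' = t then 1 else 0))"
      unfolding D by (simp only: sum1)
    also have "\<dots> = c j j' t" by (auto simp: c_def distrib_left)
    also have "D_op \<gamma> b k R 1 2 l (weight2 1 2 t v) x = weight2 1 2 t (D_op \<gamma> b k R 1 2 l v) x"
      using zw unfolding zero_weight_def comp_def by metis
    also have "\<dots> = c i i' t"
      unfolding weight2_def basis_proj_def c_def Dv by (simp add: x_def)
    finally show ?thesis .
  qed
  moreover have "d \<noteq> 0" "d + d \<noteq> 0"
    using nz mfps_double_eq_0 unfolding d_def by blast+
  ultimately have "\<forall>t. (if i = t then d else 0) + (if i' = t then d else 0) =
      (if j = t then d else 0) + (if j' = t then d else 0)" "d \<noteq> 0" "d + d \<noteq> 0"
    unfolding c_def by auto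
  then show ?thesis
    by (smt (verit) add.right_neutral add.left_neutral add_left_cancel)
qed

text \<open>Renaming turns the entry for the spaces 1 and 2 into the one for \<open>p\<close> and
  \<open>q\<close>, and renaming zero gives zero; hence the former entry is nonzero as well.\<close>

lemma zero_weight_Dker:
  assumes G: "\<And>l. invertible (bk_mat b k l)"
    and zw: "zero_weight 1 2 (D_op \<gamma> b k R 1 2)" and "p \<noteq> q"
    and nz: "Dker \<gamma> (bk_mat b k) R p q l i i' j j' \<noteq> 0"
  shows "(i = j \<and> i' = j') \<or> (i = j' \<and> i' = j)"
proof -
  obtain \<tau> :: "nat \<Rightarrow> nat" where \<tau>: "inj \<tau>" "\<tau> p = 1" "\<tau> q = 2"
    using ex_inj_two_values[OF \<open>p \<noteq> q\<close>, of 1 2] by auto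
  have "Dker \<gamma> (bk_mat b k) R 1 2 l i i' j j' \<noteq> 0"
    using rename_vars_Dker[OF \<tau>(1), of \<gamma> "bk_mat b k" R p q l i i' j j'] nz \<tau> by auto
  then show ?thesis by (rule zero_weight_Dker_12[OF G zw])
qed

lemma shift_D_op_kernel:
  assumes "p \<noteq> q" and G: "\<And>l. invertible (bk_mat b k l)" and "finite S" "p \<notin> S" "q \<notin> S"
  shows "shift \<gamma> S (D_op \<gamma> b k R p q) l =
    lin2 p q (\<lambda>x. Dker \<gamma> (bk_mat b k) R p q (l + wt \<gamma> S x) (x p) (x q))"
proof -
  have eq: "D_op \<gamma> b k R p q = (\<lambda>l. lin2 p q (\<lambda>x. Dker \<gamma> (bk_mat b k) R p q l (x p) (x q)))"
    using D_op_kernel[OF assms(1) G] by blast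
  show ?thesis
    unfolding eq using assms
    by (intro ext, subst shift_local[OF local_op_lin2[of p "{p, q}"]]) (auto simp: lin2_def)
qed

lemma shift_D_op:
  fixes b k :: "complex ^ 'n::finite \<Rightarrow> 'n mat1"
  assumes "p \<noteq> q" and G: "\<And>l. invertible (bk_mat b k l)" and S: "finite S" "p \<notin> S" "q \<notin> S"
    and R: "non_dynamical \<gamma> R"
  shows "shift \<gamma> S (D_op \<gamma> b k R p q) =
    sact1 \<gamma> (insert q S) p (\<lambda>l. matrix_inv (bk_mat b k l)) \<odot>
    sact1 \<gamma> S q (\<lambda>l. matrix_inv (bk_mat b k l)) \<odot>
    act2 p q R \<odot> sact1 \<gamma> S p (bk_mat b k) \<odot> sact1 \<gamma> (insert p S) q (bk_mat b k)"
proof -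
  note loc = local_op_sact1[where T = "{p, q}"] local_op_act2[where T = "{p, q}"]
    local_op_dmult[where T = "{p, q}"]
  show ?thesis
    unfolding D_op_eq[OF assms(1,2)] act1_eq_sact1[of _ _ \<gamma>]
    using assms by (simp add: shift_dmult[where T = "{p, q}"] loc shift_sact1 shift_act2)
qed

text \<open>Meant for the inverses B_m^{-1}, whose shift contains neither space of the D factors
  that they have to pass.\<close>

lemma sact1_D_op_commute:
  assumes "p \<noteq> q" and G: "\<And>l. invertible (bk_mat b k l)" and S: "finite S" "p \<notin> S" "q \<notin> S"
    and "a \<noteq> p" "a \<noteq> q" "a \<notin> S" "p \<notin> S'" "q \<notin> S'"
  shows "sact1 \<gamma> S' a X \<odot> shift \<gamma> S (D_op \<gamma> b k R p q) =
    shift \<gamma> S (D_op \<gamma> b k R p q) \<odot> sact1 \<gamma> S' a X"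
  unfolding dmult_def sact1_def shift_D_op_kernel[OF assms(1) G S]
  by (intro ext lin1_lin2_commute[unfolded fun_eq_iff, rule_format]) (use assms in auto)

text \<open>If both spaces of \<open>D\<close> occur in the shift, then the zero weight of \<open>D\<close> keeps the shift fixed.\<close>

lemma sact1_D_op_commute_zero_weight:
  assumes "p \<noteq> q" and G: "\<And>l. invertible (bk_mat b k l)" and S: "finite S" "p \<notin> S" "q \<notin> S"
    and zw: "zero_weight 1 2 (D_op \<gamma> b k R 1 2)"
    and "a \<noteq> p" "a \<noteq> q" "a \<notin> S" "p \<in> S'" "q \<in> S'" "finite S'"
  shows "sact1 \<gamma> S' a X \<odot> shift \<gamma> S (D_op \<gamma> b k R p q) =
    shift \<gamma> S (D_op \<gamma> b k R p q) \<odot> sact1 \<gamma> S' a X"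
proof -
  have wt: "wt \<gamma> S' (x(p := j, q := j')) = wt \<gamma> S' x"
    if "Dker \<gamma> (bk_mat b k) R p q (l + wt \<gamma> S x) (x p) (x q) j j' \<noteq> 0" for l x j j'
  proof -
    define T where "T = S' - {p, q}"
    have S': "S' = insert p (insert q T)" and T: "p \<notin> insert q T" "q \<notin> T" "finite T"
      using assms unfolding T_def by auto
    \<comment> \<open>The contributions of \<open>p\<close> and \<open>q\<close> enter
      symmetrically, so an exchange of their indices leaves the shift alone.\<close>
    have split: "wt \<gamma> S' y = \<gamma> *s eps (y p) + (\<gamma> *s eps (y q) + wt \<gamma> T y)" for y
      unfolding S' wt_def using T by (subst sum.insert; simp)
    from zero_weight_Dker[OF G zw \<open>p \<noteq> q\<close> that] show ?thesis
      unfolding split using T \<open>p \<noteq> q\<close> by auto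
  qed
  show ?thesis
    unfolding dmult_def sact1_def shift_D_op_kernel[OF assms(1) G S]
    by (intro ext lin1_lin2_commute[unfolded fun_eq_iff, rule_format])
      (use assms in \<open>auto simp: wt\<close>)
qed

section \<open>Shifted forms of A, B and C\<close>

lemma shift_A_op:
  assumes "\<And>l. invertible (b l)" "p \<noteq> q" "finite S" "p \<notin> S" "q \<notin> S" "non_dynamical \<gamma> R"
  shows "shift \<gamma> S (A_op b R p q) =
    sact1 \<gamma> S p (\<lambda>l. matrix_inv (b l)) \<odot> sact1 \<gamma> S q (\<lambda>l. matrix_inv (b l)) \<odot> act2 p q R \<odot>
    sact1 \<gamma> S p b \<odot> sact1 \<gamma> S q b"
proof -
  note loc = local_op_sact1[where T = "{p, q}"] local_op_act2[where T = "{p, q}"]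
    local_op_dmult[where T = "{p, q}"]
  show ?thesis
    unfolding A_op_def act1_eq_sact1[of _ _ \<gamma>]
    using assms by (simp add: dinv_sact1 shift_dmult[where T = "{p, q}"] loc shift_sact1 shift_act2)
qed

lemma shift_B_op:
  assumes "\<And>l. invertible (b l)" "p \<noteq> q" "finite S" "p \<notin> S" "q \<notin> S"
  shows "shift \<gamma> S (B_op \<gamma> b p q) =
    sact1 \<gamma> S q (\<lambda>l. matrix_inv (b l)) \<odot> sact1 \<gamma> (insert p S) q b"
  unfolding B_op_def act1_eq_sact1[of _ _ \<gamma>]
  using assms
  by (simp add: dinv_sact1 shift_dmult[where T = "{q}"] local_op_sact1 shift_sact1)

lemma shift_C_op:
  assumes "\<And>l. invertible (b l)" "p \<noteq> q" "finite S" "p \<notin> S" "q \<notin> S"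
  shows "shift \<gamma> S (C_op \<gamma> b p q) =
    sact1 \<gamma> S p (\<lambda>l. matrix_inv (b l)) \<odot> sact1 \<gamma> (insert q S) p b"
  unfolding C_op_def act1_eq_sact1[of _ _ \<gamma>]
  using assms
  by (simp add: dinv_sact1 shift_dmult[where T = "{p}"] local_op_sact1 shift_sact1)

section \<open>Ordered products\<close>

definition com :: "'n dynop \<Rightarrow> 'n dynop \<Rightarrow> bool" where
  "com X Y \<longleftrightarrow> X \<odot> Y = Y \<odot> X"

lemma com_left: "com X Y \<Longrightarrow> X \<odot> (Y \<odot> Z) = Y \<odot> (X \<odot> Z)"
  unfolding com_def by (metis dmult_assoc)

lemma com_sym: "com X Y \<Longrightarrow> com Y X"
  by (simp add: com_def)

lemma com_dmult: "com X Y \<Longrightarrow> com X Z \<Longrightarrow> com X (Y \<odot> Z)"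
  unfolding com_def by (metis dmult_assoc)

lemma cancel_left: "X \<odot> Y = ident \<Longrightarrow> X \<odot> (Y \<odot> Z) = Z"
  by (metis dmult_assoc dmult_id(2))

definition desc :: "(nat \<Rightarrow> 'n dynop) \<Rightarrow> nat \<Rightarrow> 'n dynop" where
  "desc X M = oprod X (rev [1..<M + 1])"

definition asc :: "(nat \<Rightarrow> 'n dynop) \<Rightarrow> nat \<Rightarrow> 'n dynop" where
  "asc X M = oprod X [1..<M + 1]"

lemma oprod_simps [simp]: "oprod X [] = ident" "oprod X (m # ms) = X m \<odot> oprod X ms"
  by (simp_all add: oprod_def ident_def fun_eq_iff)

lemma oprod_append: "oprod X (ms @ ms') = oprod X ms \<odot> oprod X ms'"
  by (induction ms) (simp_all add: dmult_assoc)

lemma desc_simps [simp]: "desc X 0 = ident" "desc X (Suc M) = X (Suc M) \<odot> desc X M"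
  by (simp_all add: desc_def)

lemma asc_simps [simp]: "asc X 0 = ident" "asc X (Suc M) = asc X M \<odot> X (Suc M)"
  by (simp_all add: asc_def oprod_append)

lemma desc_cong: "(\<And>m. 1 \<le> m \<Longrightarrow> m \<le> M \<Longrightarrow> X m = Y m) \<Longrightarrow> desc X M = desc Y M"
  by (induction M) simp_all

lemma asc_cong: "(\<And>m. 1 \<le> m \<Longrightarrow> m \<le> M \<Longrightarrow> X m = Y m) \<Longrightarrow> asc X M = asc Y M"
  by (induction M) simp_all

lemma com_desc: "(\<And>m. 1 \<le> m \<Longrightarrow> m \<le> M \<Longrightarrow> com X (Y m)) \<Longrightarrow> com X (desc Y M)"
  by (induction M) (simp_all add: com_dmult, simp add: com_def)

lemma com_asc: "(\<And>m. 1 \<le> m \<Longrightarrow> m \<le> M \<Longrightarrow> com X (Y m)) \<Longrightarrow> com X (asc Y M)"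
  by (induction M) (simp_all add: com_dmult, simp add: com_def)

text \<open>In descending order \<open>f (m - 1)\<close> is followed by \<open>fi (m - 1)\<close>,
  which cancels it. The relation \<open>fi 0 \<odot> f 0 = ident\<close> covers the empty
  product.\<close>

lemma desc_telescope:
  assumes "\<And>m. m \<le> N \<Longrightarrow> fi m \<odot> f m = ident" "\<And>m. m \<le> N \<Longrightarrow> f m \<odot> fi m = ident"
  shows "desc (\<lambda>m. fi m \<odot> X m \<odot> f (m - 1)) N = fi N \<odot> desc X N \<odot> f 0"
proof -
  have "M \<le> N \<Longrightarrow> desc (\<lambda>m. fi m \<odot> X m \<odot> f (m - 1)) M = fi M \<odot> desc X M \<odot> f 0" for M
  proof (induction M)
    case (Suc M)
    have "f M \<odot> fi M = ident" using assms(2)[of M] Suc.prems by simp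
    then show ?case
      using Suc by (simp add: dmult_assoc cancel_left)
  qed (simp add: assms(1)[of 0])
  then show ?thesis by simp
qed

text \<open>Commutation is asked for \<open>m \<le> m'\<close> only: a later \<open>K\<close>
  already stands to the left of \<open>b m'\<close>, and for the intended factors its space belongs
  to the shift of \<open>b m'\<close>.\<close>

lemma desc_dmult:
  assumes "\<And>m m'. 1 \<le> m \<Longrightarrow> m \<le> m' \<Longrightarrow> m' \<le> N \<Longrightarrow> com (b m') (K m)"
  shows "desc (\<lambda>m. b m \<odot> K m) N = desc K N \<odot> desc b N"
proof -
  have "M \<le> N \<Longrightarrow> desc (\<lambda>m. b m \<odot> K m) M = desc K M \<odot> desc b M" for M
  proof (induction M)
    case (Suc M)
    have "com (b (Suc M)) (desc K (Suc M))"
      using Suc.prems by (intro com_desc assms) auto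
    then have c: "b (Suc M) \<odot> (K (Suc M) \<odot> desc K M) = (K (Suc M) \<odot> desc K M) \<odot> b (Suc M)"
      by (simp add: com_def)
    have "desc (\<lambda>m. b m \<odot> K m) (Suc M) = (b (Suc M) \<odot> (K (Suc M) \<odot> desc K M)) \<odot> desc b M"
      using Suc by (simp add: dmult_assoc)
    then show ?case unfolding c by (simp add: dmult_assoc)
  qed simp
  then show ?thesis by simp
qed

text \<open>Since factors of different index commute, \<open>desc b\<close> reaches each conjugated
  factor and exactly one of its \<open>b m\<close> cancels the adjacent \<open>bi m\<close>.\<close>

lemma desc_conjugate:
  assumes "\<And>m. 1 \<le> m \<Longrightarrow> m \<le> N \<Longrightarrow> b m \<odot> bi m = ident"
    and "\<And>m m'. 1 \<le> m \<Longrightarrow> 1 \<le> m' \<Longrightarrow> m \<noteq> m' \<Longrightarrow> com (b m) (b m')"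
    and "\<And>m m'. 1 \<le> m \<Longrightarrow> 1 \<le> m' \<Longrightarrow> m \<noteq> m' \<Longrightarrow> com (b m) (bi m')"
    and "\<And>m m'. 1 \<le> m \<Longrightarrow> 1 \<le> m' \<Longrightarrow> m \<noteq> m' \<Longrightarrow> com (b m) (X m')"
  shows "desc b N \<odot> desc (\<lambda>m. bi m \<odot> X m \<odot> b m) N = desc X N \<odot> desc b N"
proof -
  have "M \<le> N \<Longrightarrow> desc b M \<odot> desc (\<lambda>m. bi m \<odot> X m \<odot> b m) M = desc X M \<odot> desc b M" for M
  proof (induction M)
    case (Suc M)
    let ?P = "desc (\<lambda>m. bi m \<odot> X m \<odot> b m) M" and ?m = "Suc M"
    have c: "com (desc b M) (bi ?m)" "com (desc b M) (X ?m)" "com (desc b M) (b ?m)"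
      by (rule com_sym, rule com_desc, rule com_sym, rule assms; simp)+
    have c': "com (b ?m) (desc X M)"
      by (rule com_desc, rule assms) (use Suc.prems in auto)
    have "desc b ?m \<odot> desc (\<lambda>m. bi m \<odot> X m \<odot> b m) ?m =
        b ?m \<odot> (bi ?m \<odot> (X ?m \<odot> (b ?m \<odot> (desc b M \<odot> ?P))))"
      by (simp add: dmult_assoc com_left[OF c(1)] com_left[OF c(2)] com_left[OF c(3)])
    also have "\<dots> = X ?m \<odot> (b ?m \<odot> (desc X M \<odot> desc b M))"
      using Suc assms(1)[of ?m] by (simp add: cancel_left)
    also have "\<dots> = desc X ?m \<odot> desc b ?m"
      by (simp add: dmult_assoc com_left[OF c'])
    finally show ?case .
  qed simp
  then show ?thesis by simp
qed

text \<open>Each \<open>bi\<close> moves left through the \<open>D\<close> up to its index and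
  through \<open>F\<close> to meet its \<open>b\<close>, while the \<open>bh\<close> collected so
  far move right through the next \<open>D\<close>. Thus no \<open>b\<close> has to pass a
  \<open>D\<close>; in the application the shift of \<open>b m\<close> contains one of the two
  spaces of a later \<open>D\<close> but not the other.\<close>

lemma asc_extract_shifted:
  assumes "\<And>m. 1 \<le> m \<Longrightarrow> m \<le> N \<Longrightarrow> b m \<odot> bi m = ident"
    and "\<And>m. 1 \<le> m \<Longrightarrow> m \<le> N \<Longrightarrow> com (bi m) F"
    and "\<And>m m'. 1 \<le> m \<Longrightarrow> m \<le> m' \<Longrightarrow> m' \<le> N \<Longrightarrow> com (bi m') (D m)"
    and "\<And>m m'. 1 \<le> m \<Longrightarrow> m < m' \<Longrightarrow> m' \<le> N \<Longrightarrow> com (bh m) (D m')"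
    and "\<And>m m'. 1 \<le> m \<Longrightarrow> m < m' \<Longrightarrow> m' \<le> N \<Longrightarrow> com (bi m') (bh m)"
    and "\<And>m m'. 1 \<le> m \<Longrightarrow> m < m' \<Longrightarrow> m' \<le> N \<Longrightarrow> com (bh m') (bh m)"
  shows "desc b N \<odot> F \<odot> asc (\<lambda>m. D m \<odot> (bi m \<odot> bh m)) N = F \<odot> asc D N \<odot> desc bh N"
proof -
  have "M \<le> N \<Longrightarrow> desc b M \<odot> F \<odot> asc (\<lambda>m. D m \<odot> (bi m \<odot> bh m)) M = F \<odot> asc D M \<odot> desc bh M" for M
  proof (induction M)
    case (Suc M)
    let ?m = "Suc M"
    have c1: "com (bi ?m) (desc bh M)" by (rule com_desc, rule assms) (use Suc.prems in auto)
    have c2: "com (desc bh M) (D ?m)"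
      by (rule com_sym, rule com_desc, rule com_sym, rule assms) (use Suc.prems in auto)
    have c3: "com (bi ?m) (asc D M)" by (rule com_asc, rule assms) (use Suc.prems in auto)
    have c4: "com (bi ?m) (D ?m)" "com (bi ?m) F" by (rule assms; use Suc.prems in simp)+
    have c5: "com (bh ?m) (desc bh M)" by (rule com_desc, rule assms) (use Suc.prems in auto)
    have IH: "desc b M \<odot> F \<odot> asc (\<lambda>m. D m \<odot> (bi m \<odot> bh m)) M = F \<odot> asc D M \<odot> desc bh M"
      using Suc by simp
    have "desc b ?m \<odot> F \<odot> asc (\<lambda>m. D m \<odot> (bi m \<odot> bh m)) ?m =
        b ?m \<odot> (desc b M \<odot> F \<odot> asc (\<lambda>m. D m \<odot> (bi m \<odot> bh m)) M) \<odot> (D ?m \<odot> (bi ?m \<odot> bh ?m))"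
      by (simp add: dmult_assoc)
    also have "\<dots> = b ?m \<odot> (F \<odot> (asc D M \<odot> (desc bh M \<odot> (D ?m \<odot> (bi ?m \<odot> bh ?m)))))"
      unfolding IH by (simp add: dmult_assoc)
    also have "\<dots> = b ?m \<odot> (F \<odot> (asc D M \<odot> (D ?m \<odot> (bi ?m \<odot> (desc bh M \<odot> bh ?m)))))"
      by (simp only: com_left[OF c2] com_left[OF com_sym[OF c1]])
    also have "\<dots> = b ?m \<odot> (bi ?m \<odot> (F \<odot> (asc D M \<odot> (D ?m \<odot> (desc bh M \<odot> bh ?m)))))"
      by (simp only: com_left[OF com_sym[OF c3]] com_left[OF com_sym[OF c4(1)]]
          com_left[OF com_sym[OF c4(2)]])
    also have "\<dots> = F \<odot> (asc D M \<odot> (D ?m \<odot> (bh ?m \<odot> desc bh M)))"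
      using assms(1)[of ?m] Suc.prems c5 by (simp add: cancel_left com_def)
    finally show ?case by (simp add: dmult_assoc)
  qed simp
  then show ?thesis by simp
qed

text \<open>\<open>F\<close> runs through the product: \<open>F (m - 1)\<close> absorbs the leading
  inverse of \<open>D m\<close>, exposes \<open>Ki m\<close> to \<open>K m\<close>, and reappears as
  \<open>F m\<close> on the other side of \<open>X m\<close>.\<close>

lemma asc_extract_boundary:
  assumes D: "\<And>m. 1 \<le> m \<Longrightarrow> m \<le> N \<Longrightarrow> F (m - 1) \<odot> D m = Ki m \<odot> (X m \<odot> (F m \<odot> Kh m))"
    and K: "\<And>m. 1 \<le> m \<Longrightarrow> m \<le> N \<Longrightarrow> K m \<odot> Ki m = ident"
    and "\<And>m m'. 1 \<le> m \<Longrightarrow> m < m' \<Longrightarrow> m' \<le> N \<Longrightarrow> com (Kh m) (D m')"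
    and "\<And>m m'. 1 \<le> m \<Longrightarrow> m < m' \<Longrightarrow> m' \<le> N \<Longrightarrow> com (K m') (X m)"
  shows "desc K N \<odot> F 0 \<odot> asc D N = asc X N \<odot> F N \<odot> desc Kh N"
proof -
  have "M \<le> N \<Longrightarrow> desc K M \<odot> F 0 \<odot> asc D M = asc X M \<odot> F M \<odot> desc Kh M" for M
  proof (induction M)
    case (Suc M)
    let ?m = "Suc M"
    have c1: "com (desc Kh M) (D ?m)"
      by (rule com_sym, rule com_desc, rule com_sym, rule assms) (use Suc.prems in auto)
    have c2: "com (K ?m) (asc X M)"
      by (rule com_asc, rule assms) (use Suc.prems in auto)
    have IH: "desc K M \<odot> F 0 \<odot> asc D M = asc X M \<odot> F M \<odot> desc Kh M"
      using Suc by simp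
    have "desc K ?m \<odot> F 0 \<odot> asc D ?m = K ?m \<odot> (desc K M \<odot> F 0 \<odot> asc D M) \<odot> D ?m"
      by (simp add: dmult_assoc)
    also have "\<dots> = asc X M \<odot> (K ?m \<odot> ((F M \<odot> D ?m) \<odot> desc Kh M))"
      unfolding IH using c1 by (simp add: dmult_assoc com_left[OF c2] com_def)
    also have "F M \<odot> D ?m = Ki ?m \<odot> (X ?m \<odot> (F ?m \<odot> Kh ?m))"
      using assms(1)[of ?m] Suc.prems by simp
    finally show ?case
      using assms(2)[of ?m] Suc.prems by (simp add: dmult_assoc cancel_left)
  qed simp
  then show ?thesis by simp
qed

section \<open>The decoupling operator\<close>

lemma finite_s_spaces [simp]: "finite (s_spaces N m)"
  by (simp add: s_spaces_def)

lemma even_notin_s_spaces [simp]: "2 * i \<notin> s_spaces N m" "0 \<notin> s_spaces N m"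
  unfolding s_spaces_def by (auto, presburger)

lemma odd_in_s_spaces [simp]:
  assumes "1 \<le> m'"
  shows "2 * m' - Suc 0 \<in> s_spaces N m \<longleftrightarrow> m < m' \<and> m' \<le> N"
proof
  assume "m < m' \<and> m' \<le> N"
  then show "2 * m' - Suc 0 \<in> s_spaces N m"
    unfolding s_spaces_def by (intro image_eqI[of _ _ "m' - 1"]) auto
qed (use assms in \<open>auto simp: s_spaces_def\<close>)

lemma s_spaces_last [simp]: "s_spaces N N = {}"
  by (simp add: s_spaces_def)

lemma s_spaces_prev:
  assumes "1 \<le> m" "m \<le> N"
  shows "s_spaces N (m - 1) = insert (2 * m - 1) (s_spaces N m)"
proof -
  have "{m - 1..<N} = insert (m - 1) {m..<N}" using assms by auto
  moreover have "2 * (m - 1) + 1 = 2 * m - 1" using assms by simp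
  ultimately show ?thesis by (simp only: s_spaces_def image_insert)
qed

section \<open>Exchange with the shift operator\<close>

lemma exp_shift_eq: "exp_shift \<gamma> a \<psi> l x = \<psi> (l + \<gamma> *s eps (x a)) x"
  by (simp add: exp_shift_def basis_proj_def)

text \<open>The shift operator moves lambda and so acts on functions of lambda, not fibrewise; the
  exchange relation therefore lives on the level of \<open>pointwise\<close>. In the application
  \<open>Y\<close> is \<open>X\<close> with h_0 added to the shift.\<close>

definition shifts_to :: "complex \<Rightarrow> 'n dynop \<Rightarrow> 'n::finite dynop \<Rightarrow> bool" where
  "shifts_to \<gamma> X Y \<longleftrightarrow> exp_shift \<gamma> 0 \<circ> pointwise X = pointwise Y \<circ> exp_shift \<gamma> 0"

lemma pointwise_dmult: "pointwise (X \<odot> Y) = pointwise X \<circ> pointwise Y"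
  by (simp add: fun_eq_iff pointwise_def dmult_def)

lemma shifts_to_dmult: "shifts_to \<gamma> X X' \<Longrightarrow> shifts_to \<gamma> Y Y' \<Longrightarrow> shifts_to \<gamma> (X \<odot> Y) (X' \<odot> Y')"
  unfolding shifts_to_def pointwise_dmult by (metis comp_assoc)

lemma shifts_to_desc:
  "(\<And>m. 1 \<le> m \<Longrightarrow> m \<le> M \<Longrightarrow> shifts_to \<gamma> (X m) (Y m)) \<Longrightarrow> shifts_to \<gamma> (desc X M) (desc Y M)"
proof (induction M)
  case 0
  show ?case by (simp add: shifts_to_def pointwise_def fun_eq_iff exp_shift_eq ident_def)
qed (simp add: shifts_to_dmult)

lemma shifts_to_sact1:
  assumes "a \<noteq> 0" "finite S" "0 \<notin> S"
  shows "shifts_to \<gamma> (sact1 \<gamma> S a X) (sact1 \<gamma> (insert 0 S) a X)"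
proof -
  have "wt \<gamma> (insert 0 S) x = \<gamma> *s eps (x 0) + wt \<gamma> S x" for x :: "nat \<Rightarrow> 'a"
    using assms by (simp add: wt_def)
  then show ?thesis
    using assms
    by (simp add: shifts_to_def fun_eq_iff exp_shift_eq pointwise_def sact1_def lin1_def add.assoc)
qed

section \<open>Support and invertibility of the decoupling operator\<close>

lemma acts_only_in_ident:
  assumes "finite S"
  shows "acts_only_in S (ident :: 'n::finite dynop)"
  unfolding acts_only_in_def
proof (intro exI allI)
  fix l :: "complex ^ 'n" and v :: "'n vect" and x :: "nat \<Rightarrow> 'n"
  have "(\<Sum>y \<in> S \<rightarrow>\<^sub>E UNIV. (if y = restrict x S then 1 else 0) * v (\<lambda>a. if a \<in> S then y a else x a)) =
      (\<Sum>y \<in> S \<rightarrow>\<^sub>E UNIV. if y = restrict x S then v x else 0)"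
    by (rule sum.cong) (auto intro!: arg_cong[where f = v])
  also have "\<dots> = v x" using assms by (simp add: sum.delta finite_PiE)
  finally show "ident l v x =
      (\<Sum>y \<in> S \<rightarrow>\<^sub>E UNIV. (if y = restrict x S then 1 else 0) * v (\<lambda>a. if a \<in> S then y a else x a))"
    by (simp add: ident_def)
qed

lemma acts_only_in_dmult:
  fixes X Y :: "'n::finite dynop"
  assumes "acts_only_in S X" "acts_only_in S Y"
  shows "acts_only_in S (X \<odot> Y)"
proof -
  define u where "u y x = (\<lambda>a. if a \<in> S then y a else x a)" for y x :: "nat \<Rightarrow> 'n"
  let ?P = "S \<rightarrow>\<^sub>E (UNIV :: 'n set)"
  obtain M where M: "\<And>l v x. X l v x = (\<Sum>y\<in>?P. M l (restrict x S) y * v (u y x))"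
    using assms(1) unfolding acts_only_in_def u_def by blast
  obtain M' where M': "\<And>l v x. Y l v x = (\<Sum>y\<in>?P. M' l (restrict x S) y * v (u y x))"
    using assms(2) unfolding acts_only_in_def u_def by blast
  have r: "restrict (u y x) S = y" if "y \<in> ?P" for x y
    using that by (auto simp: u_def fun_eq_iff PiE_def extensional_def)
  have uu: "u z (u y x) = u z x" for x y z
    by (auto simp: u_def)
  have "(X \<odot> Y) l v x =
      (\<Sum>z\<in>?P. (\<Sum>y\<in>?P. M l (restrict x S) y * M' l y z) * v (u z x))" for l v x
  proof -
    have "(X \<odot> Y) l v x = (\<Sum>y\<in>?P. \<Sum>z\<in>?P. M l (restrict x S) y * M' l y z * v (u z x))"
      by (simp add: dmult_def M M' uu r sum_distrib_left mult.assoc cong: sum.cong)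
    also have "\<dots> = (\<Sum>z\<in>?P. \<Sum>y\<in>?P. M l (restrict x S) y * M' l y z * v (u z x))"
      by (rule sum.swap)
    finally show ?thesis by (simp add: sum_distrib_right)
  qed
  then show ?thesis unfolding acts_only_in_def u_def
    by (intro exI[of _ "\<lambda>l x z. \<Sum>y\<in>?P. M l x y * M' l y z"]) blast
qed

lemma acts_only_in_desc:
  assumes "finite S" "\<And>m. 1 \<le> m \<Longrightarrow> m \<le> M \<Longrightarrow> acts_only_in S (X m)"
  shows "acts_only_in S (desc X M :: 'n::finite dynop)"
  using assms(2) by (induction M) (simp_all add: acts_only_in_ident acts_only_in_dmult assms(1))

text \<open>The shift spaces must lie in \<open>T\<close> too, because the matrix entries read their
  labels.\<close>

lemma acts_only_in_sact1:
  fixes X :: "complex ^ 'n::finite \<Rightarrow> 'n mat1"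
  assumes "finite T" "a \<in> T" "S \<subseteq> T"
  shows "acts_only_in T (sact1 \<gamma> S a X)"
  unfolding acts_only_in_def
proof (intro exI allI)
  fix l :: "complex ^ 'n" and v :: "'n vect" and x :: "nat \<Rightarrow> 'n"
  define c where "c x j = in_var a (X (l + wt \<gamma> S x) $ x a $ j)" for x :: "nat \<Rightarrow> 'n" and j
  let ?h = "\<lambda>j. (restrict x T)(a := j)"
  \<comment> \<open>The kernel on all of \<open>T\<close> is diagonal in every space except
    \<open>a\<close>.\<close>
  let ?M = "\<lambda>x (y :: nat \<Rightarrow> 'n). if y = x(a := y a) then in_var a (X (l + wt \<gamma> S x) $ x a $ y a) else 0"
  let ?f = "\<lambda>y. ?M (restrict x T) y * v (\<lambda>i. if i \<in> T then y i else x i)"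
  have "wt \<gamma> S (restrict x T) = wt \<gamma> S x"
    unfolding wt_def using assms(3) by (intro sum.cong) auto
  then have c: "?f (?h j) = c x j * v (x(a := j))" for j
    using assms(2) by (auto simp: c_def fun_eq_iff intro!: arg_cong2[where f = times] arg_cong[where f = v])
  have inj: "inj ?h" by (rule injI) (metis fun_upd_same)
  have "(\<Sum>y\<in>T \<rightarrow>\<^sub>E UNIV. ?f y) = (\<Sum>y\<in>range ?h. ?f y)"
  proof (rule sum.mono_neutral_right)
    show "range ?h \<subseteq> T \<rightarrow>\<^sub>E UNIV" using assms(2) by (auto simp: PiE_def extensional_def)
    show "\<forall>y\<in>(T \<rightarrow>\<^sub>E UNIV) - range ?h. ?f y = 0" by auto
  qed (use assms(1) in \<open>simp add: finite_PiE\<close>)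
  also have "\<dots> = (\<Sum>j\<in>UNIV. c x j * v (x(a := j)))"
    by (subst sum.reindex[OF inj]) (simp only: comp_def c)
  finally show "sact1 \<gamma> S a X l v x = (\<Sum>y\<in>T \<rightarrow>\<^sub>E UNIV. ?f y)"
    by (simp add: sact1_def lin1_def c_def)
qed

lemma bij_sact1:
  assumes "a \<notin> S" "\<And>l. invertible (X l)"
  shows "bij (sact1 \<gamma> S a X l)"
proof (rule o_bij)
  show "sact1 \<gamma> S a (\<lambda>l. matrix_inv (X l)) l \<circ> sact1 \<gamma> S a X l = id"
    "sact1 \<gamma> S a X l \<circ> sact1 \<gamma> S a (\<lambda>l. matrix_inv (X l)) l = id"
    using sact1_inverse[OF assms, of \<gamma>] by (simp_all add: dmult_def ident_def fun_eq_iff)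
qed

lemma bij_desc: "(\<And>m. 1 \<le> m \<Longrightarrow> m \<le> M \<Longrightarrow> bij (X m l)) \<Longrightarrow> bij (desc X M l)"
  by (induction M) (simp_all add: dmult_def ident_def bij_comp)

theorem mainTheorem5:
  fixes \<gamma> :: complex
    and b k Q chi :: "complex ^ 'n::finite \<Rightarrow> 'n mat1"
    and R :: "complex ^ 'n \<Rightarrow> 'n mat2"
    and N :: nat
  assumes "\<gamma> \<noteq> 0"
    and "\<And>l. invertible (b l)"
    and "\<And>l. invertible (k l)"
    and "non_dynamical \<gamma> R"
    and "yang_baxter R"
    and "zero_weight 1 2 (D_op \<gamma> b k R 1 2)"
    and "non_dynamical \<gamma> Q"
    and "act2 1 2 R \<odot> act1 1 Q \<odot> act1 2 Q = act1 2 Q \<odot> act1 1 Q \<odot> act2 1 2 R"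
    and "N \<ge> 1"
  shows "(\<forall>l. bij (O_op \<gamma> b k N l)) \<and> acts_only_in {1..2 * N} (O_op \<gamma> b k N) \<and>
    monodromy \<gamma> b k R Q chi N =
      pointwise (dinv (O_op \<gamma> b k N)) \<circ>
      (pointwise
         (act1 0 (\<lambda>l. transpose (chi l)) \<odot> dinv (act1 0 b) \<odot>
          oprod (\<lambda>m. act2 0 (2 * m) R) (rev [1..<N + 1]) \<odot>
          act1 0 Q \<odot>
          oprod (\<lambda>m. act2 0 (2 * m - 1) R) [1..<N + 1] \<odot>
          act1 0 b \<odot> act1 0 k) \<circ>
       exp_shift \<gamma> 0) \<circ>
      pointwise (O_op \<gamma> b k N)"
proof -
  note inv_b = assms(2) and R = assms(4) and zw = assms(6)
  note inv_G = bk_mat_invertible[of b k, OF assms(2,3)]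
  define G where "G = bk_mat b k"
  define s where "s = s_spaces N"
  define bi where "bi = (\<lambda>l. matrix_inv (b l))"
  define Gi where "Gi = (\<lambda>l. matrix_inv (G l))"
  define f where "f m = sact1 \<gamma> (s m) 0 b" for m
  define fi where "fi m = sact1 \<gamma> (s m) 0 bi" for m
  define F where "F m = sact1 \<gamma> (s m) 0 G" for m
  define Fi where "Fi m = sact1 \<gamma> (s m) 0 Gi" for m
  define B where "B m = sact1 \<gamma> (s m) (2 * m) b" for m
  define Bi where "Bi m = sact1 \<gamma> (s m) (2 * m) bi" for m
  define Bh where "Bh m = sact1 \<gamma> (insert 0 (s m)) (2 * m) b" for m
  define K where "K m = sact1 \<gamma> (s m) (2 * m - 1) G" for m
  define Ki where "Ki m = sact1 \<gamma> (s m) (2 * m - 1) Gi" for m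
  define Kh where "Kh m = sact1 \<gamma> (insert 0 (s m)) (2 * m - 1) G" for m
  define X where "X m = act2 0 (2 * m) R" for m
  define Y where "Y m = act2 0 (2 * m - 1) R" for m
  define D where "D m = shift \<gamma> (s m) (D_op \<gamma> b k R 0 (2 * m - 1))" for m
  define q where "q = act1 0 Q"
  define c where "c = act1 0 (\<lambda>l. transpose (chi l))"
  note defs = f_def fi_def F_def Fi_def B_def Bi_def Bh_def K_def Ki_def Kh_def X_def Y_def
  note ndefs = defs bi_def Gi_def G_def s_def

  have odd_even: "2 * i - Suc 0 \<noteq> 2 * j" "2 * j \<noteq> 2 * i - Suc 0" if "1 \<le> i" for i j :: nat
    using that by presburger+
  have odd_inj: "2 * i - Suc 0 = 2 * j - Suc 0 \<longleftrightarrow> i = j" if "1 \<le> i" "1 \<le> j" for i j :: nat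
    using that by presburger

  have inv:
    "fi m \<odot> f m = ident" "f m \<odot> fi m = ident" "B m \<odot> Bi m = ident" "F m \<odot> Fi m = ident"
    "1 \<le> m \<Longrightarrow> K m \<odot> Ki m = ident" for m
    unfolding ndefs by (rule sact1_inverse; simp add: inv_b inv_G)+

  have AC: "shift \<gamma> (s m) (A_op b R 0 (2 * m)) \<odot> shift \<gamma> (s m) (C_op \<gamma> b 0 (2 * m - 1)) =
      fi m \<odot> (Bi m \<odot> X m \<odot> B m) \<odot> f (m - 1)" if m: "1 \<le> m" "m \<le> N" for m
  proof -
    have A: "shift \<gamma> (s m) (A_op b R 0 (2 * m)) = fi m \<odot> Bi m \<odot> X m \<odot> f m \<odot> B m"
      unfolding ndefs by (rule shift_A_op) (use m R inv_b in auto)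
    have C: "shift \<gamma> (s m) (C_op \<gamma> b 0 (2 * m - 1)) = fi m \<odot> f (m - 1)"
      unfolding ndefs s_spaces_prev[OF m] by (rule shift_C_op) (use m inv_b in auto)
    have "com (B m) (f m)" "com (B m) (fi m)"
      unfolding ndefs com_def by (rule sact1_commute; use m in simp)+
    then show ?thesis
      unfolding A C by (simp add: dmult_assoc com_left com_def cancel_left inv)
  qed

  have DB: "shift \<gamma> (s m) (D_op \<gamma> b k R 0 (2 * m - 1)) \<odot> shift \<gamma> (s m) (B_op \<gamma> b 0 (2 * m)) =
      D m \<odot> (Bi m \<odot> Bh m)" if m: "1 \<le> m" "m \<le> N" for m
  proof -
    have "shift \<gamma> (s m) (B_op \<gamma> b 0 (2 * m)) = Bi m \<odot> Bh m"
      unfolding ndefs by (rule shift_B_op) (use m inv_b in auto)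
    then show ?thesis by (simp add: D_def)
  qed

  have FD: "F (m - 1) \<odot> D m = Ki m \<odot> (Y m \<odot> (F m \<odot> Kh m))" if m: "1 \<le> m" "m \<le> N" for m
  proof -
    have "D m = Fi (m - 1) \<odot> Ki m \<odot> Y m \<odot> F m \<odot> Kh m"
      unfolding D_def ndefs s_spaces_prev[OF m]
      by (rule shift_D_op) (use m R inv_G in auto)
    then show ?thesis by (simp add: dmult_assoc cancel_left inv)
  qed

  \<comment> \<open>\<open>s m'\<close> begins with the space 2m'+1, so for
    \<open>m \<le> m'\<close> it contains neither 0 nor 2m-1.\<close>
  have com_D: "com (Bi m') (D m)" if "1 \<le> m" "m \<le> m'" "m' \<le> N" for m m'
    unfolding D_def ndefs com_def
    by (rule sact1_D_op_commute) (use that inv_G odd_even in auto)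
  \<comment> \<open>For \<open>m < m'\<close> both 0 and 2m'-1 lie in \<open>insert 0 (s m)\<close>.
    Strictness matters, since 2m-1 is not in \<open>s m\<close>.\<close>
  have com_D_zw: "com (Bh m) (D m')" "com (Kh m) (D m')" if "1 \<le> m" "m < m'" "m' \<le> N" for m m'
    unfolding D_def ndefs com_def
    by (rule sact1_D_op_commute_zero_weight; use that inv_G zw odd_even odd_inj in simp)+

  define E where "E = desc B N"
  define Eh where "Eh = desc Bh N"
  define L where "L = desc K N"
  define Lh where "Lh = desc Kh N"

  have O_eq: "O_op \<gamma> b k N = desc (\<lambda>m. B m \<odot> K m) N"
    unfolding O_op_def desc_def[symmetric]
    by (rule desc_cong) (simp add: B_def K_def G_def s_def shift_act1)
  have O_split: "O_op \<gamma> b k N = L \<odot> E"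
    unfolding O_eq L_def E_def
    by (rule desc_dmult) (unfold ndefs com_def, rule sact1_commute, use odd_even in auto)
  have Oh_split: "desc (\<lambda>m. Bh m \<odot> Kh m) N = Lh \<odot> Eh"
    unfolding Lh_def Eh_def
    by (rule desc_dmult) (unfold ndefs com_def, rule sact1_commute, use odd_even in auto)

  have left: "desc (\<lambda>m. shift \<gamma> (s m) (A_op b R 0 (2 * m)) \<odot>
      shift \<gamma> (s m) (C_op \<gamma> b 0 (2 * m - 1))) N = fi N \<odot> desc (\<lambda>m. Bi m \<odot> X m \<odot> B m) N \<odot> f 0"
  proof -
    have "desc (\<lambda>m. shift \<gamma> (s m) (A_op b R 0 (2 * m)) \<odot>
        shift \<gamma> (s m) (C_op \<gamma> b 0 (2 * m - 1))) N =
      desc (\<lambda>m. fi m \<odot> (Bi m \<odot> X m \<odot> B m) \<odot> f (m - 1)) N"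
      by (rule desc_cong) (rule AC)
    also have "\<dots> = fi N \<odot> desc (\<lambda>m. Bi m \<odot> X m \<odot> B m) N \<odot> f 0"
      by (rule desc_telescope; rule inv)
    finally show ?thesis .
  qed
  have conj: "E \<odot> desc (\<lambda>m. Bi m \<odot> X m \<odot> B m) N = desc X N \<odot> E"
    unfolding E_def
    by (rule desc_conjugate; (rule inv)?;
        (unfold ndefs com_def, rule sact1_commute sact1_act2_commute; simp)?)
  have right: "E \<odot> F 0 \<odot> asc (\<lambda>m. D m \<odot> (Bi m \<odot> Bh m)) N = F 0 \<odot> asc D N \<odot> Eh"
    unfolding E_def Eh_def
    by (rule asc_extract_shifted; (rule inv com_D com_D_zw)?; (assumption | simp)?;
        unfold ndefs com_def; rule sact1_commute; simp)
  have bound: "L \<odot> F 0 \<odot> asc D N = asc Y N \<odot> F N \<odot> Lh"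
    unfolding L_def Lh_def
    by (rule asc_extract_boundary; (rule FD inv(5) com_D_zw(2))?; (assumption | simp)?;
        unfold ndefs com_def; rule sact1_act2_commute; simp add: odd_inj)

  \<comment> \<open>The factor b_0(s_0) left by the telescoping cancels the inverse in b^{-1} Q b k,
    and Q, being non-dynamical, loses its shift.\<close>
  have fQ: "f 0 \<odot> shift \<gamma> (s 0) (act1 0 (k_tilde b Q k)) = q \<odot> F 0"
  proof -
    have "b l ** k_tilde b Q k l = Q l ** G l" for l
    proof -
      have "b l ** k_tilde b Q k l = (b l ** matrix_inv (b l)) ** Q l ** (b l ** k l)"
        by (simp add: k_tilde_def matrix_mul_assoc)
      then show ?thesis
        using matrix_inv_inverse[OF inv_b, of l] by (simp add: G_def bk_mat_def matrix_mul_lid)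
    qed
    then show ?thesis
      by (simp add: ndefs q_def shift_act1 sact1_mult assms(7)
          sact1_non_dynamical[of "s_spaces N 0" \<gamma> Q 0, symmetric])
  qed

  have com_E0: "com E (sact1 \<gamma> {} 0 Z)" for Z
    unfolding E_def
    by (rule com_sym, rule com_desc, unfold ndefs com_def, rule sact1_commute) auto
  \<comment> \<open>Restricted to unshifted factors: \<open>L\<close> acts in the odd spaces, all of
    which occur in the shift of \<open>F 0\<close>. Hence \<open>L\<close> stops in front of
    \<open>F 0\<close>, where \<open>bound\<close> takes over.\<close>
  have com_L0: "com L (sact1 \<gamma> {} 0 Z)" for Z
    unfolding L_def
    by (rule com_sym, rule com_desc, unfold ndefs com_def, rule sact1_commute) auto
  have com_E: "com E c" "com E (fi N)" "com E q" and com_L: "com L c" "com L (fi N)" "com L q"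
    using com_E0 com_L0 by (simp_all add: c_def q_def fi_def s_def act1_eq_sact1[of _ _ \<gamma>])
  have com_L_X: "com L (desc X N)"
    unfolding L_def
    by (rule com_desc, rule com_sym, rule com_desc, rule com_sym, unfold ndefs com_def,
        rule sact1_act2_commute) (use odd_even in auto)

  define T where "T = c \<odot> (fi N \<odot> desc (\<lambda>m. Bi m \<odot> X m \<odot> B m) N \<odot> f 0) \<odot>
    shift \<gamma> (s 0) (act1 0 (k_tilde b Q k)) \<odot> asc (\<lambda>m. D m \<odot> (Bi m \<odot> Bh m)) N"
  define W where "W = c \<odot> fi N \<odot> desc X N \<odot> q \<odot> asc Y N \<odot> F N"
  have "O_op \<gamma> b k N \<odot> T = L \<odot> (E \<odot> (c \<odot> (fi N \<odot> (desc (\<lambda>m. Bi m \<odot> X m \<odot> B m) N \<odot>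
      ((f 0 \<odot> shift \<gamma> (s 0) (act1 0 (k_tilde b Q k))) \<odot> asc (\<lambda>m. D m \<odot> (Bi m \<odot> Bh m)) N)))))"
    unfolding O_split T_def by (simp only: dmult_assoc)
  also have "\<dots> = L \<odot> (c \<odot> (fi N \<odot> ((E \<odot> desc (\<lambda>m. Bi m \<odot> X m \<odot> B m) N) \<odot>
      (q \<odot> (F 0 \<odot> asc (\<lambda>m. D m \<odot> (Bi m \<odot> Bh m)) N)))))"
    unfolding fQ by (simp only: dmult_assoc com_E[THEN com_left])
  also have "\<dots> = L \<odot> (c \<odot> (fi N \<odot> (desc X N \<odot>
      (q \<odot> (E \<odot> F 0 \<odot> asc (\<lambda>m. D m \<odot> (Bi m \<odot> Bh m)) N)))))"
    unfolding conj by (simp only: dmult_assoc com_E[THEN com_left])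
  also have "\<dots> = c \<odot> (fi N \<odot> (desc X N \<odot> (q \<odot> ((L \<odot> F 0 \<odot> asc D N) \<odot> Eh))))"
    unfolding right by (simp only: dmult_assoc com_L[THEN com_left] com_left[OF com_L_X])
  also have "\<dots> = W \<odot> desc (\<lambda>m. Bh m \<odot> Kh m) N"
    unfolding bound Oh_split W_def by (simp only: dmult_assoc)
  finally have OT: "O_op \<gamma> b k N \<odot> T = W \<odot> desc (\<lambda>m. Bh m \<odot> Kh m) N" .

  have bij: "bij (O_op \<gamma> b k N l)" for l
    unfolding O_eq
  proof (rule bij_desc)
    fix m :: nat assume "1 \<le> m"
    then have "bij (B m l)" "bij (K m l)"
      unfolding ndefs by (intro bij_sact1; simp add: inv_b inv_G)+
    then show "bij ((B m \<odot> K m) l)" unfolding dmult_def by (rule bij_comp[rotated])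
  qed
  have acts: "acts_only_in {1..2 * N} (O_op \<gamma> b k N)"
    unfolding O_eq
  proof (intro acts_only_in_desc acts_only_in_dmult)
    fix m assume m: "1 \<le> m" "m \<le> N"
    have "2 * m \<in> {1..2 * N}" "2 * m - 1 \<in> {1..2 * N}"
      using m unfolding atLeastAtMost_iff by linarith+
    moreover have "s m \<subseteq> {1..2 * N}" unfolding s_def s_spaces_def by auto
    ultimately show "acts_only_in {1..2 * N} (B m)" "acts_only_in {1..2 * N} (K m)"
      unfolding B_def K_def by (intro acts_only_in_sact1; simp)+
  qed simp

  have "shifts_to \<gamma> (O_op \<gamma> b k N) (desc (\<lambda>m. Bh m \<odot> Kh m) N)"
    unfolding O_eq ndefs by (intro shifts_to_desc shifts_to_dmult shifts_to_sact1) auto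
  then have shift_O: "exp_shift \<gamma> 0 \<circ> pointwise (O_op \<gamma> b k N) =
      pointwise (desc (\<lambda>m. Bh m \<odot> Kh m) N) \<circ> exp_shift \<gamma> 0"
    unfolding shifts_to_def .

  have "dinv (O_op \<gamma> b k N) \<odot> O_op \<gamma> b k N = ident"
    unfolding dmult_def dinv_def ident_def using bij by (auto intro!: ext simp: bij_is_inj)
  then have T: "T = dinv (O_op \<gamma> b k N) \<odot> (W \<odot> desc (\<lambda>m. Bh m \<odot> Kh m) N)"
    unfolding OT[symmetric] by (simp add: cancel_left)

  have DB_prod: "asc (\<lambda>m. shift \<gamma> (s m) (D_op \<gamma> b k R 0 (2 * m - 1)) \<odot>
      shift \<gamma> (s m) (B_op \<gamma> b 0 (2 * m))) N = asc (\<lambda>m. D m \<odot> (Bi m \<odot> Bh m)) N"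
    by (rule asc_cong) (rule DB)
  have "monodromy \<gamma> b k R Q chi N = pointwise T \<circ> exp_shift \<gamma> 0"
    unfolding monodromy_def desc_def[symmetric] asc_def[symmetric] s_def[symmetric] left
      DB_prod T_def c_def ..
  also have "\<dots> = pointwise (dinv (O_op \<gamma> b k N)) \<circ> (pointwise W \<circ> exp_shift \<gamma> 0) \<circ>
      pointwise (O_op \<gamma> b k N)"
    unfolding T pointwise_dmult comp_assoc shift_O ..
  also have "W = act1 0 (\<lambda>l. transpose (chi l)) \<odot> dinv (act1 0 b) \<odot>
      oprod (\<lambda>m. act2 0 (2 * m) R) (rev [1..<N + 1]) \<odot> act1 0 Q \<odot>
      oprod (\<lambda>m. act2 0 (2 * m - 1) R) [1..<N + 1] \<odot> act1 0 b \<odot> act1 0 k"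
  proof -
    \<comment> \<open>\<open>s N\<close> is empty, so \<open>fi N\<close> and \<open>F N\<close>
      carry no shift.\<close>
    have "dinv (act1 0 b) = fi N"
      unfolding act1_eq_sact1[of _ _ \<gamma>] ndefs by (simp add: dinv_sact1 inv_b)
    moreover have "act1 0 b \<odot> act1 0 k = F N"
      unfolding act1_eq_sact1[of _ _ \<gamma>] ndefs by (simp add: sact1_mult bk_mat_def[abs_def])
    ultimately show ?thesis
      unfolding desc_def[symmetric] asc_def[symmetric] X_def[symmetric] Y_def[symmetric]
        q_def[symmetric] c_def[symmetric] W_def by (simp add: dmult_assoc)
  qed
  finally show ?thesis using bij acts by blast
qed

end
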